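(* Let $(H,\Delta)$ be a Hopf algebra with invariant functionals, $(A,\alpha)$ an $I$-Galois object, and $\psi_A$ a left complete invariant functional on $A$. Then there is a bijection $\mu:I\to I$ such that $\psi_{ij}\neq0$ if and only if $j=\mu(i)$. Moreover, for any invariant functional $\widetilde\psi$ on $A$ there are scalars $c_i\in k$ ($i\in I$) such that $\widetilde\psi_{ij}=\delta_{j,\mu(i)}c_i\psi_{ij}$ for all $i,j\in I$.
   Context: $H$ has invariant functionals: nonzero $\varphi,\psi:H\to k$ with $(\mathrm{id}\otimes\varphi)\Delta(h)=\varphi(h)1$, $(\psi\otimes\mathrm{id})\Delta(h)=\psi(h)1$. An $I$-Galois object is a right $H$-comodule algebra $(A,\alpha)$ (possibly non-unital) with bijective Galois map $A\otimes_{A^\alpha}A\to A\otimes H$, $a\otimes b\mapsto(a\otimes1)\alpha(b)$, and coinvariant algebra $A^\alpha$ identified with $k_I=\bigoplus_{i\in I}k$, minimal idempotents $p_i$. A functional $\chi:A\to k$ is invariant if $(\chi\otimes\mathrm{id})\alpha(x)=\chi(x)1_H$ for all $x$; left complete if $\chi(p_i\,\cdot)\ne0$ for all $i$. For a functional $\chi$, $\chi_{ij}:A\to k$, $a\mapsto\chi(p_iap_j)$; $\delta_{j,\mu(i)}$ is the Kronecker delta. *)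

theory Defs
  imports Complex_Main
begin

definition bilin ::
  "('k::field \<Rightarrow> 'v::ab_group_add \<Rightarrow> 'v) \<Rightarrow> ('k \<Rightarrow> 'w::ab_group_add \<Rightarrow> 'w) \<Rightarrow>
   ('k \<Rightarrow> 'u::ab_group_add \<Rightarrow> 'u) \<Rightarrow> ('v \<Rightarrow> 'w \<Rightarrow> 'u) \<Rightarrow> bool" where
  "bilin s1 s2 s3 f \<longleftrightarrow>
     (\<forall>v. Vector_Spaces.linear s2 s3 (f v)) \<and> (\<forall>w. Vector_Spaces.linear s1 s3 (\<lambda>v. f v w))"

text \<open>(sT, t) is a tensor product of V and W: t is bilinear, its image spans T, and
every bilinear form on V x W factors through a linear functional on T.  Over a field
this characterises V \<otimes> W up to unique isomorphism compatible with t.\<close>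
definition is_tensor_product ::
  "('k::field \<Rightarrow> 'v::ab_group_add \<Rightarrow> 'v) \<Rightarrow> ('k \<Rightarrow> 'w::ab_group_add \<Rightarrow> 'w) \<Rightarrow>
   ('k \<Rightarrow> 't::ab_group_add \<Rightarrow> 't) \<Rightarrow> ('v \<Rightarrow> 'w \<Rightarrow> 't) \<Rightarrow> bool" where
  "is_tensor_product s1 s2 sT t \<longleftrightarrow>
     vector_space s1 \<and> vector_space s2 \<and> vector_space sT \<and> bilin s1 s2 sT t \<and>
     module.span sT (range (case_prod t)) = UNIV \<and>
     (\<forall>\<beta>. bilin s1 s2 ((*)::'k\<Rightarrow>'k\<Rightarrow>'k) \<beta> \<longrightarrow>
        (\<exists>f. Vector_Spaces.linear sT ((*)::'k\<Rightarrow>'k\<Rightarrow>'k) f \<and> (\<forall>v w. f (t v w) = \<beta> v w)))"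

definition tlift ::
  "('k::field \<Rightarrow> 't::ab_group_add \<Rightarrow> 't) \<Rightarrow> ('k \<Rightarrow> 'x::ab_group_add \<Rightarrow> 'x) \<Rightarrow>
   ('v \<Rightarrow> 'w \<Rightarrow> 't) \<Rightarrow> ('v \<Rightarrow> 'w \<Rightarrow> 'x) \<Rightarrow> 't \<Rightarrow> 'x" where
  "tlift sT sX t \<beta> = (THE F. Vector_Spaces.linear sT sX F \<and> (\<forall>v w. F (t v w) = \<beta> v w))"

definition tmult ::
  "('k::field \<Rightarrow> 't::ab_group_add \<Rightarrow> 't) \<Rightarrow> ('v::ring \<Rightarrow> 'w::ring \<Rightarrow> 't) \<Rightarrow> 't \<Rightarrow> 't \<Rightarrow> 't" where
  "tmult sT t x y = tlift sT sT t (\<lambda>a h. tlift sT sT t (\<lambda>b g. t (a * b) (h * g)) y) x"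

text \<open>The map V\<otimes>W \<rightarrow> (V\<otimes>W)\<otimes>X given by (id \<otimes> D) followed by the associativity
isomorphism V\<otimes>(W\<otimes>X) \<cong> (V\<otimes>W)\<otimes>X, where D : W \<rightarrow> W\<otimes>X.\<close>
definition id_tensor_assoc ::
  "('k::field \<Rightarrow> 'vw::ab_group_add \<Rightarrow> 'vw) \<Rightarrow> ('k \<Rightarrow> 'wx::ab_group_add \<Rightarrow> 'wx) \<Rightarrow>
   ('k \<Rightarrow> 'vwx::ab_group_add \<Rightarrow> 'vwx) \<Rightarrow>
   ('v \<Rightarrow> 'w \<Rightarrow> 'vw) \<Rightarrow> ('w \<Rightarrow> 'x \<Rightarrow> 'wx) \<Rightarrow> ('vw \<Rightarrow> 'x \<Rightarrow> 'vwx) \<Rightarrow>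
   ('w \<Rightarrow> 'wx) \<Rightarrow> 'vw \<Rightarrow> 'vwx" where
  "id_tensor_assoc sVW sWX sVWX tVW tWX tVWX D =
     tlift sVW sVWX tVW (\<lambda>v w. tlift sWX sVWX tWX (\<lambda>w' x. tVWX (tVW v w') x) (D w))"

definition is_algebra :: "('k::field \<Rightarrow> 'a::ring \<Rightarrow> 'a) \<Rightarrow> bool" where
  "is_algebra s \<longleftrightarrow> vector_space s \<and>
     (\<forall>c x y. s c (x * y) = s c x * y \<and> s c (x * y) = x * s c y)"

definition hopf_algebra ::
  "('k::field \<Rightarrow> 'h::ring_1 \<Rightarrow> 'h) \<Rightarrow> ('k \<Rightarrow> 'hh::ab_group_add \<Rightarrow> 'hh) \<Rightarrow>
   ('k \<Rightarrow> 'hhh::ab_group_add \<Rightarrow> 'hhh) \<Rightarrow> ('h \<Rightarrow> 'h \<Rightarrow> 'hh) \<Rightarrow> ('hh \<Rightarrow> 'h \<Rightarrow> 'hhh) \<Rightarrow>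
   ('h \<Rightarrow> 'hh) \<Rightarrow> ('h \<Rightarrow> 'k) \<Rightarrow> ('h \<Rightarrow> 'h) \<Rightarrow> bool" where
  "hopf_algebra sH sHH sHHH tHH tHHH \<Delta> \<epsilon> S \<longleftrightarrow>
     is_algebra sH \<and> is_tensor_product sH sH sHH tHH \<and> is_tensor_product sHH sH sHHH tHHH \<and>
     Vector_Spaces.linear sH sHH \<Delta> \<and> Vector_Spaces.linear sH (*) \<epsilon> \<and> Vector_Spaces.linear sH sH S \<and>
     \<comment> \<open>coassociativity: (\<Delta>\<otimes>id)\<Delta> = (id\<otimes>\<Delta>)\<Delta>\<close>
     (\<forall>h. tlift sHH sHHH tHH (\<lambda>a b. tHHH (\<Delta> a) b) (\<Delta> h)
            = id_tensor_assoc sHH sHH sHHH tHH tHH tHHH \<Delta> (\<Delta> h)) \<and>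
     \<comment> \<open>counit: (\<epsilon>\<otimes>id)\<Delta> = id = (id\<otimes>\<epsilon>)\<Delta>\<close>
     (\<forall>h. tlift sHH sH tHH (\<lambda>a b. sH (\<epsilon> a) b) (\<Delta> h) = h) \<and>
     (\<forall>h. tlift sHH sH tHH (\<lambda>a b. sH (\<epsilon> b) a) (\<Delta> h) = h) \<and>
     \<comment> \<open>\<Delta> and \<epsilon> are unital algebra homomorphisms\<close>
     (\<forall>x y. \<Delta> (x * y) = tmult sHH tHH (\<Delta> x) (\<Delta> y)) \<and> \<Delta> 1 = tHH 1 1 \<and>
     (\<forall>x y. \<epsilon> (x * y) = \<epsilon> x * \<epsilon> y) \<and> \<epsilon> 1 = 1 \<and>
     \<comment> \<open>antipode: m(S\<otimes>id)\<Delta> = \<epsilon>(\<cdot>)1 = m(id\<otimes>S)\<Delta>\<close>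
     (\<forall>h. tlift sHH sH tHH (\<lambda>a b. S a * b) (\<Delta> h) = sH (\<epsilon> h) 1) \<and>
     (\<forall>h. tlift sHH sH tHH (\<lambda>a b. a * S b) (\<Delta> h) = sH (\<epsilon> h) 1)"

definition has_invariant_functionals ::
  "('k::field \<Rightarrow> 'h::ring_1 \<Rightarrow> 'h) \<Rightarrow> ('k \<Rightarrow> 'hh::ab_group_add \<Rightarrow> 'hh) \<Rightarrow>
   ('h \<Rightarrow> 'h \<Rightarrow> 'hh) \<Rightarrow> ('h \<Rightarrow> 'hh) \<Rightarrow> bool" where
  "has_invariant_functionals sH sHH tHH \<Delta> \<longleftrightarrow>
     (\<exists>\<phi> \<psi>. Vector_Spaces.linear sH ((*)::'k\<Rightarrow>'k\<Rightarrow>'k) \<phi> \<and> Vector_Spaces.linear sH ((*)::'k\<Rightarrow>'k\<Rightarrow>'k) \<psi> \<and>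
        (\<exists>h. \<phi> h \<noteq> 0) \<and> (\<exists>h. \<psi> h \<noteq> 0) \<and>
        (\<forall>h. tlift sHH sH tHH (\<lambda>a b. sH (\<phi> b) a) (\<Delta> h) = sH (\<phi> h) 1) \<and>
        (\<forall>h. tlift sHH sH tHH (\<lambda>a b. sH (\<psi> a) b) (\<Delta> h) = sH (\<psi> h) 1))"

definition comodule_algebra ::
  "('k::field \<Rightarrow> 'a::ring \<Rightarrow> 'a) \<Rightarrow> ('k \<Rightarrow> 'h::ring_1 \<Rightarrow> 'h) \<Rightarrow> ('k \<Rightarrow> 'hh::ab_group_add \<Rightarrow> 'hh) \<Rightarrow>
   ('k \<Rightarrow> 'ah::ab_group_add \<Rightarrow> 'ah) \<Rightarrow> ('k \<Rightarrow> 'ahh::ab_group_add \<Rightarrow> 'ahh) \<Rightarrow>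
   ('h \<Rightarrow> 'h \<Rightarrow> 'hh) \<Rightarrow> ('a \<Rightarrow> 'h \<Rightarrow> 'ah) \<Rightarrow> ('ah \<Rightarrow> 'h \<Rightarrow> 'ahh) \<Rightarrow>
   ('h \<Rightarrow> 'hh) \<Rightarrow> ('h \<Rightarrow> 'k) \<Rightarrow> ('a \<Rightarrow> 'ah) \<Rightarrow> bool" where
  "comodule_algebra sA sH sHH sAH sAHH tHH tAH tAHH \<Delta> \<epsilon> \<alpha> \<longleftrightarrow>
     is_algebra sA \<and> is_tensor_product sA sH sAH tAH \<and> is_tensor_product sAH sH sAHH tAHH \<and>
     Vector_Spaces.linear sA sAH \<alpha> \<and>
     (\<forall>x y. \<alpha> (x * y) = tmult sAH tAH (\<alpha> x) (\<alpha> y)) \<and>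
     \<comment> \<open>(\<alpha>\<otimes>id)\<alpha> = (id\<otimes>\<Delta>)\<alpha>\<close>
     (\<forall>x. tlift sAH sAHH tAH (\<lambda>a h. tAHH (\<alpha> a) h) (\<alpha> x)
            = id_tensor_assoc sAH sHH sAHH tAH tHH tAHH \<Delta> (\<alpha> x)) \<and>
     \<comment> \<open>(id\<otimes>\<epsilon>)\<alpha> = id\<close>
     (\<forall>x. tlift sAH sA tAH (\<lambda>a h. sA (\<epsilon> h) a) (\<alpha> x) = x)"

definition coinvariants :: "('a \<Rightarrow> 'h::one \<Rightarrow> 'ah) \<Rightarrow> ('a \<Rightarrow> 'ah) \<Rightarrow> 'a set" where
  "coinvariants tAH \<alpha> = {a. \<alpha> a = tAH a 1}"

text \<open>I-Galois object: (A,\<alpha>) comodule algebra; A^\<alpha> is identified with k_I, its minimal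
idempotents being p i (i \<in> I): the p i are nonzero, pairwise orthogonal idempotents
spanning A^\<alpha>; and the Galois map A \<otimes>_{A^\<alpha>} A \<rightarrow> A\<otimes>H is bijective.  A\<otimes>A is realised by
tAA; the balanced tensor product A \<otimes>_{A^\<alpha>} A is the quotient of A\<otimes>A by the span of the
elements ap\<otimes>b - a\<otimes>pb (p \<in> A^\<alpha>), so bijectivity means: the induced map on A\<otimes>A is surjective
and its kernel is exactly that span.\<close>
definition galois_object ::
  "('k::field \<Rightarrow> 'a::ring \<Rightarrow> 'a) \<Rightarrow> ('k \<Rightarrow> 'h::ring_1 \<Rightarrow> 'h) \<Rightarrow> ('k \<Rightarrow> 'hh::ab_group_add \<Rightarrow> 'hh) \<Rightarrow>
   ('k \<Rightarrow> 'ah::ab_group_add \<Rightarrow> 'ah) \<Rightarrow> ('k \<Rightarrow> 'ahh::ab_group_add \<Rightarrow> 'ahh) \<Rightarrow>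
   ('k \<Rightarrow> 'aa::ab_group_add \<Rightarrow> 'aa) \<Rightarrow>
   ('h \<Rightarrow> 'h \<Rightarrow> 'hh) \<Rightarrow> ('a \<Rightarrow> 'h \<Rightarrow> 'ah) \<Rightarrow> ('ah \<Rightarrow> 'h \<Rightarrow> 'ahh) \<Rightarrow> ('a \<Rightarrow> 'a \<Rightarrow> 'aa) \<Rightarrow>
   ('h \<Rightarrow> 'hh) \<Rightarrow> ('h \<Rightarrow> 'k) \<Rightarrow> ('a \<Rightarrow> 'ah) \<Rightarrow> 'i set \<Rightarrow> ('i \<Rightarrow> 'a) \<Rightarrow> bool" where
  "galois_object sA sH sHH sAH sAHH sAA tHH tAH tAHH tAA \<Delta> \<epsilon> \<alpha> I p \<longleftrightarrow>
     comodule_algebra sA sH sHH sAH sAHH tHH tAH tAHH \<Delta> \<epsilon> \<alpha> \<and>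
     is_tensor_product sA sA sAA tAA \<and>
     (\<forall>i\<in>I. p i \<noteq> 0 \<and> p i * p i = p i) \<and>
     (\<forall>i\<in>I. \<forall>j\<in>I. i \<noteq> j \<longrightarrow> p i * p j = 0) \<and>
     coinvariants tAH \<alpha> = module.span sA (p ` I) \<and>
     (let G = tlift sAA sAH tAA (\<lambda>a b. tmult sAH tAH (tAH a 1) (\<alpha> b)) in
        surj G \<and>
        {z. G z = 0} = module.span sAA
           {tAA (a * q) b - tAA a (q * b) | a b q. q \<in> coinvariants tAH \<alpha>})"

definition invariant_functional ::
  "('k::field \<Rightarrow> 'a::ab_group_add \<Rightarrow> 'a) \<Rightarrow> ('k \<Rightarrow> 'h::{ab_group_add,one} \<Rightarrow> 'h) \<Rightarrow>
   ('k \<Rightarrow> 'ah::ab_group_add \<Rightarrow> 'ah) \<Rightarrow> ('a \<Rightarrow> 'h \<Rightarrow> 'ah) \<Rightarrow> ('a \<Rightarrow> 'ah) \<Rightarrow> ('a \<Rightarrow> 'k) \<Rightarrow> bool" where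
  "invariant_functional sA sH sAH tAH \<alpha> \<chi> \<longleftrightarrow>
     Vector_Spaces.linear sA ((*)::'k\<Rightarrow>'k\<Rightarrow>'k) \<chi> \<and>
     (\<forall>x. tlift sAH sH tAH (\<lambda>a h. sH (\<chi> a) h) (\<alpha> x) = sH (\<chi> x) 1)"

definition left_complete :: "'i set \<Rightarrow> ('i \<Rightarrow> 'a::times) \<Rightarrow> ('a \<Rightarrow> 'k::zero) \<Rightarrow> bool" where
  "left_complete I p \<chi> \<longleftrightarrow> (\<forall>i\<in>I. \<exists>a. \<chi> (p i * a) \<noteq> 0)"

definition corner :: "('i \<Rightarrow> 'a::times) \<Rightarrow> ('a \<Rightarrow> 'k) \<Rightarrow> 'i \<Rightarrow> 'i \<Rightarrow> 'a \<Rightarrow> 'k" where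
  "corner p \<chi> i j = (\<lambda>a. \<chi> (p i * a * p j))"

end

theory Submission
  imports Defs
begin

text \<open>Right integrals on \<open>H\<close> are unique up to scalars. Hence there is a grouplike \<open>g\<close> with
  \<open>h\<^sub>1 \<psi>(h\<^sub>2) = \<psi>(h) g\<close> for every right integral \<open>\<psi>\<close>, and \<open>\<phi> \<circ> S\<close> is a right integral for every left
  integral \<open>\<phi>\<close>. So \<open>R(b) = b\<^sub>0 \<phi>(S b\<^sub>1)\<close> lies in \<open>A\<^sub>g = {a. \<alpha>(a) = a \<otimes> g}\<close>, while \<open>E(a) = a\<^sub>0 \<phi>(a\<^sub>1)\<close> is
  coinvariant, and every invariant functional satisfies \<open>\<psi>(E(a) b) = \<psi>(a R(b))\<close>. For any grouplike
  \<open>x\<close>, applying \<open>\<phi>(x\<inverse> \<cdot>)\<close> to the second leg of the surjective Galois map gives \<open>A = A A\<^sub>x\<close>. Taking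
  \<open>x = g, g\<inverse>, 1\<close>, this makes \<open>A\<^sub>g\<close> an invertible bimodule over \<open>k\<^sub>I\<close>, that is, the bimodule of a
  permutation \<open>\<mu>\<close> of \<open>I\<close>: \<open>p\<^sub>i A\<^sub>g\<close> is a line, contained in \<open>A p\<^sub>\<mu>\<^sub>(\<^sub>i\<^sub>)\<close>. Choosing \<open>a\<close> with
  \<open>E(a) p\<^sub>i = p\<^sub>i\<close>, the formula \<open>\<psi>(p\<^sub>i b) = \<psi>(a p\<^sub>i R(b))\<close> shows that \<open>\<psi>(p\<^sub>i \<cdot>)\<close> is determined up to a
  scalar and supported on column \<open>\<mu>(i)\<close>.\<close>

section \<open>Tensor products and Sweedler sums\<close>

abbreviation linear_functional ::
  "('k::field \<Rightarrow> 'v::ab_group_add \<Rightarrow> 'v) \<Rightarrow> ('v \<Rightarrow> 'k) \<Rightarrow> bool" where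
  "linear_functional s \<equiv> Vector_Spaces.linear s ((*) :: 'k \<Rightarrow> 'k \<Rightarrow> 'k)"

definition trilin ::
  "('k::field \<Rightarrow> 'u::ab_group_add \<Rightarrow> 'u) \<Rightarrow> ('k \<Rightarrow> 'v::ab_group_add \<Rightarrow> 'v) \<Rightarrow>
   ('k \<Rightarrow> 'w::ab_group_add \<Rightarrow> 'w) \<Rightarrow> ('k \<Rightarrow> 'x::ab_group_add \<Rightarrow> 'x) \<Rightarrow> ('u \<Rightarrow> 'v \<Rightarrow> 'w \<Rightarrow> 'x) \<Rightarrow> bool" where
  "trilin s1 s2 s3 sX \<gamma> \<longleftrightarrow>
     (\<forall>u v. Vector_Spaces.linear s3 sX (\<gamma> u v)) \<and> (\<forall>u w. Vector_Spaces.linear s2 sX (\<lambda>v. \<gamma> u v w)) \<and>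
     (\<forall>v w. Vector_Spaces.linear s1 sX (\<lambda>u. \<gamma> u v w))"

named_theorems linearity

lemma vector_space_times: "vector_space ((*) :: 'k::field \<Rightarrow> 'k \<Rightarrow> 'k)"
  by unfold_locales (simp_all add: algebra_simps)

lemmas [linearity] =
  Vector_Spaces.linear_iff bilin_def trilin_def vector_space_times
  distrib_left distrib_right mult_ac

lemma linear_image_sum:
  "Vector_Spaces.linear s1 s2 f \<Longrightarrow> f (\<Sum>x\<in>A. g x) = (\<Sum>x\<in>A. f (g x))"
  by (simp add: linear_iff_module_hom module_hom.sum)

lemma linear_image_0: "Vector_Spaces.linear s1 s2 f \<Longrightarrow> f 0 = 0"
  by (simp add: linear_iff_module_hom module_hom.zero)

text \<open>The first two equations hold between functions, so that they also apply to eta-contracted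
  terms.\<close>
lemma bilin_add_scale:
  assumes "bilin s1 s2 s3 f"
  shows "f (x + y) = (\<lambda>w. f x w + f y w)" "f (s1 c x) = (\<lambda>w. s3 c (f x w))"
    and "f x (v + w) = f x v + f x w" "f x (s2 c w) = s3 c (f x w)"
  using assms by (simp_all add: linearity fun_eq_iff)

lemma algebra_scale_mult:
  assumes "is_algebra s"
  shows "s c x * y = s c (x * y)" "x * s c y = s c (x * y)"
  using assms unfolding is_algebra_def by metis+

lemma linear_functional_eqI:
  fixes s :: "'k::field \<Rightarrow> 'v::ab_group_add \<Rightarrow> 'v"
  assumes "vector_space s" and eq: "\<And>f. linear_functional s f \<Longrightarrow> f v = f w"
  shows "v = w"
proof (rule ccontr)
  assume "v \<noteq> w"
  interpret vector_space_pair s "(*) :: 'k \<Rightarrow> 'k \<Rightarrow> 'k"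
    using assms(1) vector_space_times by (simp add: vector_space_pair_def)
  have "vs1.independent {v - w}" using \<open>v \<noteq> w\<close> by simp
  from linear_independent_extend[OF this, of "\<lambda>_. 1"]
  obtain f where "linear_functional s f" "f (v - w) = 1" by auto
  with eq[of f] linear_diff[of f v w] show False by simp
qed

lemma pure_tensor_basis_exists:
  assumes "is_tensor_product s1 s2 sT t"
  obtains C where "C \<subseteq> range (case_prod t)" "\<not> module.dependent sT C" "module.span sT C = UNIV"
proof -
  interpret vector_space sT using assms by (simp add: is_tensor_product_def)
  obtain C where C: "C \<subseteq> range (case_prod t)" "independent C" "range (case_prod t) \<subseteq> span C"
    using maximal_independent_subset by blast
  from C(3) have "span (range (case_prod t)) \<subseteq> span C"
    by (rule span_minimal) (rule subspace_span)
  with assms C(1,2) that show thesis by (simp add: is_tensor_product_def top.extremum_unique)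
qed

text \<open>The universal property is only assumed for scalar-valued bilinear forms; testing against
  linear functionals extends it to arbitrary targets.\<close>
lemma tensor_lift_exists:
  fixes s1 :: "'k::field \<Rightarrow> 'v::ab_group_add \<Rightarrow> 'v"
    and sX :: "'k \<Rightarrow> 'x::ab_group_add \<Rightarrow> 'x"
  assumes T: "is_tensor_product s1 s2 sT t" and \<beta>: "bilin s1 s2 sX \<beta>"
  shows "\<exists>F. Vector_Spaces.linear sT sX F \<and> (\<forall>v w. F (t v w) = \<beta> v w)"
proof -
  have spaces: "vector_space sT" "vector_space sX"
    using T \<beta> by (auto simp: is_tensor_product_def linearity)
  interpret vector_space_pair sT sX using spaces by (simp add: vector_space_pair_def)
  obtain C where C: "C \<subseteq> range (case_prod t)" "vs1.independent C" "vs1.span C = UNIV"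
    using pure_tensor_basis_exists[OF T] by blast
  define F where "F = construct C (\<lambda>c. case_prod \<beta> (SOME vw. c = case_prod t vw))"
  have F: "Vector_Spaces.linear sT sX F"
    unfolding F_def by (rule linear_construct[OF C(2)])
  have "F (t v w) = \<beta> v w" for v w
  proof (rule linear_functional_eqI[OF spaces(2)])
    fix f :: "'x \<Rightarrow> 'k" assume f: "linear_functional sX f"
    then have "bilin s1 s2 (*) (\<lambda>v w. f (\<beta> v w))"
      using \<beta> by (auto simp: linearity)
    then obtain L where L: "linear_functional sT L" "\<And>v w. L (t v w) = f (\<beta> v w)"
      using T unfolding is_tensor_product_def by blast
    have fF: "linear_functional sT (\<lambda>u. f (F u))"
      using F f by (auto simp: linearity)
    interpret k: vector_space_pair sT "(*) :: 'k \<Rightarrow> 'k \<Rightarrow> 'k"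
      using spaces vector_space_times by (simp add: vector_space_pair_def)
    have "L (t v w) = f (F (t v w))"
    proof (rule k.linear_eq_on[OF L(1) fF])
      fix c assume c: "c \<in> C"
      then obtain vw where "c = case_prod t vw" using C(1) by auto
      then have "c = case_prod t (SOME vw. c = case_prod t vw)" by (rule someI)
      moreover have "F c = case_prod \<beta> (SOME vw. c = case_prod t vw)"
        unfolding F_def by (rule construct_basis[OF C(2) c])
      ultimately show "L c = f (F c)" using L(2) by (metis case_prod_beta)
    qed (simp add: C(3))
    then show "f (F (t v w)) = f (\<beta> v w)" by (simp add: L(2))
  qed
  with F show ?thesis by blast
qed

lemma linear_eq_on_tensors:
  assumes T: "is_tensor_product s1 s2 sT t"
    and F: "Vector_Spaces.linear sT sX F" and G: "Vector_Spaces.linear sT sX G"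
    and eq: "\<And>v w. F (t v w) = G (t v w)"
  shows "F u = G u"
proof -
  interpret vector_space_pair sT sX
    using F by (simp add: vector_space_pair_def linearity)
  show ?thesis
  proof (rule linear_eq_on[OF F G])
    show "u \<in> vs1.span (range (case_prod t))" using T by (simp add: is_tensor_product_def)
  qed (use eq in auto)
qed

lemma
  assumes T: "is_tensor_product s1 s2 sT t" and \<beta>: "bilin s1 s2 sX \<beta>"
  shows linear_tlift: "Vector_Spaces.linear sT sX (tlift sT sX t \<beta>)"
    and tlift_tensor: "tlift sT sX t \<beta> (t v w) = \<beta> v w"
proof -
  have "\<exists>!F. Vector_Spaces.linear sT sX F \<and> (\<forall>v w. F (t v w) = \<beta> v w)"
    using tensor_lift_exists[OF T \<beta>] linear_eq_on_tensors[OF T, of sX]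
    by (metis (no_types, lifting) ext)
  from theI'[OF this] show "Vector_Spaces.linear sT sX (tlift sT sX t \<beta>)"
    "tlift sT sX t \<beta> (t v w) = \<beta> v w" unfolding tlift_def by auto
qed

lemma span_tensors_with_basis:
  assumes T: "is_tensor_product s1 s2 sT t" and B: "module.span s2 B = UNIV"
  shows "module.span sT {t v c | v c. c \<in> B} = UNIV"
proof -
  interpret T: vector_space sT using T by (simp add: is_tensor_product_def)
  have "t v w \<in> T.span {t v c | v c. c \<in> B}" for v w
  proof -
    have "module_hom s2 sT (t v)"
      using T by (simp add: is_tensor_product_def bilin_def linear_iff_module_hom)
    from module_hom.span_image[OF this, of B] have "t v w \<in> T.span (t v ` B)" by (simp add: B)
    moreover have "t v ` B \<subseteq> {t v c | v c. c \<in> B}" by auto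
    ultimately show ?thesis using T.span_mono by blast
  qed
  then have "range (case_prod t) \<subseteq> T.span {t v c | v c. c \<in> B}" by auto
  from T.span_minimal[OF this T.subspace_span] T show ?thesis
    by (simp add: is_tensor_product_def top.extremum_unique)
qed

lemma tensor_expansion_exists:
  assumes T: "is_tensor_product s1 s2 sT t" and B: "module.span s2 B = UNIV"
  shows "\<exists>C m. finite C \<and> C \<subseteq> B \<and> u = (\<Sum>c\<in>C. t (m c) c)"
proof -
  interpret T: vector_space sT using T by (simp add: is_tensor_product_def)
  have t: "t (x + y) w = t x w + t y w" "t (s1 a x) w = sT a (t x w)" "t 0 w = 0" for a x y w
    using T linear_image_0[of s1 sT "\<lambda>v. t v w"] by (simp_all add: is_tensor_product_def linearity)
  have "u \<in> T.span {t v c | v c. c \<in> B}" by (simp add: span_tensors_with_basis[OF T B])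
  then show ?thesis
  proof (induction rule: T.span_induct_alt)
    case base
    show ?case by (rule exI[of _ "{}"]) simp
  next
    case (step a x y)
    then obtain v b C m where x: "x = t v b" "b \<in> B"
      and y: "finite C" "C \<subseteq> B" "y = (\<Sum>c\<in>C. t (m c) c)" by blast
    define n where "n c = (if c = b then s1 a v else 0) + (if c \<in> C then m c else 0)" for c
    have "sT a x = (\<Sum>c\<in>insert b C. t (if c = b then s1 a v else 0) c)"
      using y(1) by (simp add: x t if_distrib[of "\<lambda>v. t v _"] cong: if_cong)
    moreover have "y = (\<Sum>c\<in>insert b C. t (if c \<in> C then m c else 0) c)"
      unfolding y(3) using y(1) by (intro sum.mono_neutral_cong_left) (auto simp: t)
    ultimately have "sT a x + y = (\<Sum>c\<in>insert b C. t (n c) c)"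
      by (simp only: n_def t sum.distrib)
    with x y show ?case by (intro exI[of _ "insert b C"] exI[of _ n]) auto
  qed
qed

definition tensor_rep ::
  "('k::field \<Rightarrow> 'w::ab_group_add \<Rightarrow> 'w) \<Rightarrow> ('v \<Rightarrow> 'w \<Rightarrow> 't::ab_group_add) \<Rightarrow> 't \<Rightarrow>
   'w set \<times> ('w \<Rightarrow> 'v)" where
  "tensor_rep s2 t u =
     (SOME r. finite (fst r) \<and> \<not> module.dependent s2 (fst r) \<and> u = (\<Sum>c\<in>fst r. t (snd r c) c))"

lemma
  assumes T: "is_tensor_product s1 s2 sT t"
  shows finite_tensor_rep: "finite (fst (tensor_rep s2 t u))"
    and independent_tensor_rep: "\<not> module.dependent s2 (fst (tensor_rep s2 t u))"
    and tensor_rep_sum: "u = (\<Sum>c\<in>fst (tensor_rep s2 t u). t (snd (tensor_rep s2 t u) c) c)"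
proof -
  interpret vector_space s2 using T by (simp add: is_tensor_product_def)
  have basis: "independent (extend_basis {})" "span (extend_basis {}) = UNIV"
    by (auto simp: independent_extend_basis independent_empty)
  then have "\<exists>r. finite (fst r) \<and> independent (fst r) \<and> u = (\<Sum>c\<in>fst r. t (snd r c) c)"
    using tensor_expansion_exists[OF T basis(2), of u] independent_mono by (metis fst_conv snd_conv)
  from someI_ex[OF this]
  show "finite (fst (tensor_rep s2 t u))" "\<not> module.dependent s2 (fst (tensor_rep s2 t u))"
    "u = (\<Sum>c\<in>fst (tensor_rep s2 t u). t (snd (tensor_rep s2 t u) c) c)"
    unfolding tensor_rep_def by auto
qed

text \<open>Sweedler notation: for \<open>u = \<Sum>\<^sub>c v\<^sub>c \<otimes> c\<close>, \<open>sweedler s2 t u \<beta>\<close> is \<open>\<Sum>\<^sub>c \<beta> v\<^sub>c c\<close>. Fixing one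
  expansion of each tensor makes this a plain finite sum for every \<open>\<beta>\<close>, so that sums over different
  tensors can be interchanged without side conditions; it is independent of the expansion only when
  \<open>\<beta>\<close> is bilinear.\<close>
definition sweedler ::
  "('k::field \<Rightarrow> 'w::ab_group_add \<Rightarrow> 'w) \<Rightarrow> ('v \<Rightarrow> 'w \<Rightarrow> 't::ab_group_add) \<Rightarrow> 't \<Rightarrow>
   ('v \<Rightarrow> 'w \<Rightarrow> 'x::ab_group_add) \<Rightarrow> 'x" where
  "sweedler s2 t u \<beta> = (\<Sum>c\<in>fst (tensor_rep s2 t u). \<beta> (snd (tensor_rep s2 t u) c) c)"

lemma sweedler_0 [simp]: "sweedler s t u (\<lambda>a b. 0) = 0"
  by (simp add: sweedler_def)

lemma sweedler_swap:
  "sweedler s t u (\<lambda>a b. sweedler s' t' u' (\<lambda>c d. \<beta> a b c d)) =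
   sweedler s' t' u' (\<lambda>c d. sweedler s t u (\<lambda>a b. \<beta> a b c d))"
  unfolding sweedler_def by (rule sum.swap)

lemma sweedler_add [linearity]:
  "sweedler s t u (\<lambda>a b. \<beta> a b + \<gamma> a b) = sweedler s t u \<beta> + sweedler s t u \<gamma>"
  unfolding sweedler_def by (rule sum.distrib)

lemma linear_sweedler:
  "Vector_Spaces.linear sX sY f \<Longrightarrow> f (sweedler s t u \<beta>) = sweedler s t u (\<lambda>a b. f (\<beta> a b))"
  unfolding sweedler_def by (rule linear_image_sum)

lemma scale_sweedler:
  "vector_space sX \<Longrightarrow> sX c (sweedler s t u \<beta>) = sweedler s t u (\<lambda>a b. sX c (\<beta> a b))"
  unfolding sweedler_def by (simp add: module.scale_sum_right module_iff_vector_space)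

lemmas [linearity] = scale_sweedler[OF vector_space_times]

lemma tlift_eq_sweedler:
  assumes T: "is_tensor_product s1 s2 sT t" and \<beta>: "bilin s1 s2 sX \<beta>"
  shows "tlift sT sX t \<beta> u = sweedler s2 t u \<beta>"
proof -
  have "tlift sT sX t \<beta> u = tlift sT sX t \<beta> (sweedler s2 t u t)"
    using tensor_rep_sum[OF T, of u] by (simp add: sweedler_def)
  also have "\<dots> = sweedler s2 t u \<beta>"
    by (simp add: linear_sweedler[OF linear_tlift[OF T \<beta>]] tlift_tensor[OF T \<beta>])
  finally show ?thesis .
qed

lemma linear_sweedler_left:
  assumes T: "is_tensor_product s1 s2 sT t" and \<beta>: "bilin s1 s2 sX \<beta>"
  shows "Vector_Spaces.linear sT sX (\<lambda>u. sweedler s2 t u \<beta>)"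
  using linear_tlift[OF T \<beta>] by (simp add: linearity tlift_eq_sweedler[OF T \<beta>])

lemma sweedler_tensor:
  assumes T: "is_tensor_product s1 s2 sT t" and \<beta>: "bilin s1 s2 sX \<beta>"
  shows "sweedler s2 t (t v w) \<beta> = \<beta> v w"
  using tlift_tensor[OF T \<beta>] by (simp add: tlift_eq_sweedler[OF T \<beta>])

lemma sweedler_self:
  assumes "is_tensor_product s1 s2 sT t"
  shows "sweedler s2 t u t = u"
  using tensor_rep_sum[OF assms, of u] by (simp add: sweedler_def)

text \<open>The right coefficients of the chosen expansion are independent, so a family \<open>f\<close> of functionals
  that kills the first leg of \<open>u\<close> kills each left coefficient.\<close>
lemma sweedler_left_leg_zero:
  fixes s2 :: "'k::field \<Rightarrow> 'w::ab_group_add \<Rightarrow> 'w" and f :: "'v::ab_group_add \<Rightarrow> 'y \<Rightarrow> 'k"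
  assumes T: "is_tensor_product s1 s2 sT t"
    and zero: "\<And>y. sweedler s2 t u (\<lambda>v w. s2 (f v y) w) = 0" and \<gamma>: "\<And>w. \<gamma> (\<lambda>_. 0) w = 0"
  shows "sweedler s2 t u (\<lambda>v w. \<gamma> (f v) w) = 0"
  unfolding sweedler_def
proof (rule sum.neutral, rule ballI)
  interpret vector_space s2 using T by (simp add: is_tensor_product_def)
  fix c assume c: "c \<in> fst (tensor_rep s2 t u)"
  have "f (snd (tensor_rep s2 t u) c) y = 0" for y
    using independentD[OF independent_tensor_rep[OF T] finite_tensor_rep[OF T] order_refl
        zero[unfolded sweedler_def] c] .
  then have "f (snd (tensor_rep s2 t u) c) = (\<lambda>_. 0)" by blast
  then show "\<gamma> (f (snd (tensor_rep s2 t u) c)) c = 0" by (simp add: \<gamma>)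
qed

lemma tmult_eq_sweedler:
  assumes T: "is_tensor_product s1 s2 sT t" and A: "is_algebra s1" "is_algebra s2"
  shows "tmult sT t x y = sweedler s2 t x (\<lambda>a h. sweedler s2 t y (\<lambda>b g. t (a * b) (h * g)))"
proof -
  have sT: "vector_space sT" and t: "bilin s1 s2 sT t"
    using T by (auto simp: is_tensor_product_def)
  note simps = linearity scale_sweedler[OF sT]
    algebra_scale_mult[OF A(1)] algebra_scale_mult[OF A(2)]
  have inner: "bilin s1 s2 sT (\<lambda>b g. t (a * b) (h * g))" for a h
    using t by (simp add: simps)
  have outer: "bilin s1 s2 sT (\<lambda>a h. sweedler s2 t y (\<lambda>b g. t (a * b) (h * g)))"
    using t by (simp add: simps)
  show ?thesis
    unfolding tmult_def by (simp add: tlift_eq_sweedler[OF T inner] tlift_eq_sweedler[OF T outer])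
qed

section \<open>Hopf algebras and comodule algebras\<close>

locale hopf =
  fixes sH :: "'k::field \<Rightarrow> 'h::ring_1 \<Rightarrow> 'h"
    and sHH :: "'k \<Rightarrow> 'hh::ab_group_add \<Rightarrow> 'hh"
    and sHHH :: "'k \<Rightarrow> 'hhh::ab_group_add \<Rightarrow> 'hhh"
    and tHH :: "'h \<Rightarrow> 'h \<Rightarrow> 'hh" and tHHH :: "'hh \<Rightarrow> 'h \<Rightarrow> 'hhh"
    and \<Delta> :: "'h \<Rightarrow> 'hh" and \<epsilon> :: "'h \<Rightarrow> 'k" and S :: "'h \<Rightarrow> 'h"
  assumes hopf: "hopf_algebra sH sHH sHHH tHH tHHH \<Delta> \<epsilon> S"
begin

abbreviation sum\<Delta> :: "'h \<Rightarrow> ('h \<Rightarrow> 'h \<Rightarrow> 'x::ab_group_add) \<Rightarrow> 'x" where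
  "sum\<Delta> h \<beta> \<equiv> sweedler sH tHH (\<Delta> h) \<beta>"

lemma algebra_H: "is_algebra sH"
  and tensor_HH: "is_tensor_product sH sH sHH tHH"
  and linear_\<Delta>: "Vector_Spaces.linear sH sHH \<Delta>"
  and linear_\<epsilon>: "linear_functional sH \<epsilon>"
  and linear_S: "Vector_Spaces.linear sH sH S"
  using hopf unfolding hopf_algebra_def by auto

lemma vector_space_H: "vector_space sH" and vector_space_HH: "vector_space sHH"
  and bilin_HH: "bilin sH sH sHH tHH"
  using tensor_HH by (auto simp: is_tensor_product_def)

lemmas [linearity] =
  vector_space_H vector_space.vector_space_assms[OF vector_space_H]
  scale_sweedler[OF vector_space_H]
  vector_space_HH vector_space.vector_space_assms[OF vector_space_HH]
  scale_sweedler[OF vector_space_HH]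
  algebra_scale_mult[OF algebra_H] linear_\<Delta>[unfolded Vector_Spaces.linear_iff]
  linear_\<epsilon>[unfolded Vector_Spaces.linear_iff] linear_S[unfolded Vector_Spaces.linear_iff]
  bilin_add_scale[OF bilin_HH]

lemma counit_left: "sum\<Delta> h (\<lambda>a b. sH (\<epsilon> a) b) = h"
  and counit_right: "sum\<Delta> h (\<lambda>a b. sH (\<epsilon> b) a) = h"
  and antipode_left: "sum\<Delta> h (\<lambda>a b. S a * b) = sH (\<epsilon> h) 1"
  and antipode_right: "sum\<Delta> h (\<lambda>a b. a * S b) = sH (\<epsilon> h) 1"
proof -
  have "bilin sH sH sH (\<lambda>a b. sH (\<epsilon> a) b)" "bilin sH sH sH (\<lambda>a b. sH (\<epsilon> b) a)"
    "bilin sH sH sH (\<lambda>a b. S a * b)" "bilin sH sH sH (\<lambda>a b. a * S b)"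
    by (simp_all add: linearity)
  note this[THEN tlift_eq_sweedler[OF tensor_HH]]
  then show "sum\<Delta> h (\<lambda>a b. sH (\<epsilon> a) b) = h" "sum\<Delta> h (\<lambda>a b. sH (\<epsilon> b) a) = h"
    "sum\<Delta> h (\<lambda>a b. S a * b) = sH (\<epsilon> h) 1" "sum\<Delta> h (\<lambda>a b. a * S b) = sH (\<epsilon> h) 1"
    using hopf unfolding hopf_algebra_def by metis+
qed

lemma counit_mult: "\<epsilon> (x * y) = \<epsilon> x * \<epsilon> y" and counit_one: "\<epsilon> 1 = 1"
  using hopf unfolding hopf_algebra_def by auto

end

locale hopf_comodule = hopf sH sHH sHHH tHH tHHH \<Delta> \<epsilon> S
  for sH :: "'k::field \<Rightarrow> 'h::ring_1 \<Rightarrow> 'h"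
    and sHH :: "'k \<Rightarrow> 'hh::ab_group_add \<Rightarrow> 'hh"
    and sHHH :: "'k \<Rightarrow> 'hhh::ab_group_add \<Rightarrow> 'hhh"
    and tHH :: "'h \<Rightarrow> 'h \<Rightarrow> 'hh" and tHHH :: "'hh \<Rightarrow> 'h \<Rightarrow> 'hhh"
    and \<Delta> :: "'h \<Rightarrow> 'hh" and \<epsilon> :: "'h \<Rightarrow> 'k" and S :: "'h \<Rightarrow> 'h" +
  fixes sA :: "'k \<Rightarrow> 'a::ring \<Rightarrow> 'a"
    and sAH :: "'k \<Rightarrow> 'ah::ab_group_add \<Rightarrow> 'ah"
    and sAHH :: "'k \<Rightarrow> 'ahh::ab_group_add \<Rightarrow> 'ahh"
    and tAH :: "'a \<Rightarrow> 'h \<Rightarrow> 'ah" and tAHH :: "'ah \<Rightarrow> 'h \<Rightarrow> 'ahh"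
    and \<alpha> :: "'a \<Rightarrow> 'ah"
  assumes comodule: "comodule_algebra sA sH sHH sAH sAHH tHH tAH tAHH \<Delta> \<epsilon> \<alpha>"
begin

abbreviation sum\<alpha> :: "'a \<Rightarrow> ('a \<Rightarrow> 'h \<Rightarrow> 'x::ab_group_add) \<Rightarrow> 'x" where
  "sum\<alpha> a \<beta> \<equiv> sweedler sH tAH (\<alpha> a) \<beta>"

lemma algebra_A: "is_algebra sA"
  and tensor_AH: "is_tensor_product sA sH sAH tAH"
  and tensor_AHH: "is_tensor_product sAH sH sAHH tAHH"
  and linear_\<alpha>: "Vector_Spaces.linear sA sAH \<alpha>"
  using comodule unfolding comodule_algebra_def by auto

lemma vector_space_A: "vector_space sA" and vector_space_AH: "vector_space sAH"
  and vector_space_AHH: "vector_space sAHH"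
  and bilin_AH: "bilin sA sH sAH tAH" and bilin_AHH: "bilin sAH sH sAHH tAHH"
  using tensor_AH tensor_AHH by (auto simp: is_tensor_product_def)

lemmas [linearity] =
  vector_space_A vector_space.vector_space_assms[OF vector_space_A]
  scale_sweedler[OF vector_space_A]
  vector_space_AH vector_space.vector_space_assms[OF vector_space_AH]
  scale_sweedler[OF vector_space_AH]
  vector_space_AHH vector_space.vector_space_assms[OF vector_space_AHH]
  scale_sweedler[OF vector_space_AHH]
  algebra_scale_mult[OF algebra_A] linear_\<alpha>[unfolded Vector_Spaces.linear_iff]
  bilin_add_scale[OF bilin_AH] bilin_add_scale[OF bilin_AHH]

lemma linear_sum\<alpha>: "bilin sA sH sX \<beta> \<Longrightarrow> Vector_Spaces.linear sA sX (\<lambda>a. sum\<alpha> a \<beta>)"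
  using linear_sweedler_left[OF tensor_AH, of sX \<beta>] linear_\<alpha> by (simp add: Vector_Spaces.linear_iff)

lemma coassoc_tensor:
  "sum\<alpha> a (\<lambda>x h. tAHH (\<alpha> x) h) = sum\<alpha> a (\<lambda>x h. sum\<Delta> h (\<lambda>k l. tAHH (tAH x k) l))"
proof -
  have coact: "bilin sA sH sAHH (\<lambda>x h. tAHH (\<alpha> x) h)"
    and assoc: "bilin sH sH sAHH (\<lambda>k l. tAHH (tAH x k) l)" for x
    by (simp_all add: linearity)
  have "Vector_Spaces.linear sH sAHH (\<lambda>h. sum\<Delta> h (\<lambda>k l. tAHH (tAH x k) l))" for x
    using linear_sweedler_left[OF tensor_HH assoc] linear_\<Delta> by (simp add: Vector_Spaces.linear_iff)
  then have comult: "bilin sA sH sAHH (\<lambda>x h. sum\<Delta> h (\<lambda>k l. tAHH (tAH x k) l))"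
    by (simp add: linearity)
  show ?thesis
    using comodule unfolding comodule_algebra_def id_tensor_assoc_def
    by (simp add: tlift_eq_sweedler[OF tensor_AH coact] tlift_eq_sweedler[OF tensor_HH assoc]
        tlift_eq_sweedler[OF tensor_AH comult])
qed

lemma coassoc:
  assumes \<gamma>: "trilin sA sH sH sX \<gamma>"
  shows "sum\<alpha> a (\<lambda>x h. sum\<alpha> x (\<lambda>y k. \<gamma> y k h)) = sum\<alpha> a (\<lambda>x h. sum\<Delta> h (\<lambda>k l. \<gamma> x k l))"
proof -
  have sX: "vector_space sX" and \<gamma>h: "bilin sA sH sX (\<lambda>y k. \<gamma> y k h)" for h
    using \<gamma> by (simp_all add: linearity)
  have \<delta>: "bilin sAH sH sX (\<lambda>u h. sweedler sH tAH u (\<lambda>y k. \<gamma> y k h))"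
    using linear_sweedler_left[OF tensor_AH \<gamma>h] \<gamma> by (simp add: linearity scale_sweedler[OF sX])
  define \<Gamma> where "\<Gamma> z = sweedler sH tAHH z (\<lambda>u h. sweedler sH tAH u (\<lambda>y k. \<gamma> y k h))" for z
  have \<Gamma>: "Vector_Spaces.linear sAHH sX \<Gamma>"
    unfolding \<Gamma>_def by (rule linear_sweedler_left[OF tensor_AHH \<delta>])
  have \<Gamma>_tensor: "\<Gamma> (tAHH u h) = sweedler sH tAH u (\<lambda>y k. \<gamma> y k h)" for u h
    unfolding \<Gamma>_def by (rule sweedler_tensor[OF tensor_AHH \<delta>])
  show ?thesis
    using arg_cong[OF coassoc_tensor, of \<Gamma> a]
    by (simp add: linear_sweedler[OF \<Gamma>] \<Gamma>_tensor sweedler_tensor[OF tensor_AH \<gamma>h])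
qed

lemma sum\<alpha>_mult:
  assumes "bilin sA sH sX \<beta>"
  shows "sum\<alpha> (x * y) \<beta> = sum\<alpha> x (\<lambda>a h. sum\<alpha> y (\<lambda>b g. \<beta> (a * b) (h * g)))"
proof -
  have "\<alpha> (x * y) = sum\<alpha> x (\<lambda>a h. sum\<alpha> y (\<lambda>b g. tAH (a * b) (h * g)))"
    using comodule tmult_eq_sweedler[OF tensor_AH algebra_A algebra_H]
    unfolding comodule_algebra_def by simp
  then show ?thesis
    by (simp add: linear_sweedler[OF linear_sweedler_left[OF tensor_AH assms]]
        sweedler_tensor[OF tensor_AH assms])
qed

lemma coaction_counit: "sum\<alpha> a (\<lambda>x h. sA (\<epsilon> h) x) = a"
proof -
  have "bilin sA sH sA (\<lambda>x h. sA (\<epsilon> h) x)" by (simp add: linearity)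
  from tlift_eq_sweedler[OF tensor_AH this] show ?thesis
    using comodule unfolding comodule_algebra_def by simp
qed

subsection \<open>Slices and homogeneous elements\<close>

definition slice :: "('h \<Rightarrow> 'k) \<Rightarrow> 'a \<Rightarrow> 'a" where
  "slice f a = sum\<alpha> a (\<lambda>x h. sA (f h) x)"

lemma bilin_slice: "linear_functional sH f \<Longrightarrow> bilin sA sH sA (\<lambda>x h. sA (f h) x)"
  by (simp add: linearity)

lemma linear_slice: "linear_functional sH f \<Longrightarrow> Vector_Spaces.linear sA sA (slice f)"
  unfolding slice_def[abs_def] by (rule linear_sum\<alpha>[OF bilin_slice])

lemma linear_image_slice:
  assumes "Vector_Spaces.linear sA sX F"
  shows "F (slice f a) = sum\<alpha> a (\<lambda>x h. sX (f h) (F x))"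
  using assms unfolding slice_def linear_sweedler[OF assms] by (simp add: Vector_Spaces.linear_iff)

definition homogeneous :: "'h \<Rightarrow> 'a set" where
  "homogeneous x = {a. \<alpha> a = tAH a x}"

lemma coinvariants_eq_homogeneous: "coinvariants tAH \<alpha> = homogeneous 1"
  by (simp add: coinvariants_def homogeneous_def)

lemma sum\<alpha>_homogeneous: "a \<in> homogeneous x \<Longrightarrow> bilin sA sH sX \<beta> \<Longrightarrow> sum\<alpha> a \<beta> = \<beta> a x"
  using sweedler_tensor[OF tensor_AH] by (simp add: homogeneous_def)

lemma homogeneous_scale: "a \<in> homogeneous x \<Longrightarrow> sA c a \<in> homogeneous x"
  by (simp add: homogeneous_def linearity)

lemma homogeneous_mult:
  assumes a: "a \<in> homogeneous x" and b: "b \<in> homogeneous y"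
  shows "a * b \<in> homogeneous (x * y)"
proof -
  have left: "bilin sA sH sAH (\<lambda>d h. tAH (d * c) (h * g))"
    and right: "bilin sA sH sAH (\<lambda>d h. tAH (c * d) (g * h))" for c g
    by (simp_all add: linearity)
  have "\<alpha> (a * b) = sum\<alpha> (a * b) tAH" by (simp add: sweedler_self[OF tensor_AH])
  also have "\<dots> = tAH (a * b) (x * y)"
    by (simp add: sum\<alpha>_mult[OF bilin_AH] sum\<alpha>_homogeneous[OF b right] sum\<alpha>_homogeneous[OF a left])
  finally show ?thesis by (simp add: homogeneous_def)
qed

lemma homogeneous_coinvariant_mult:
  assumes "a \<in> homogeneous x" and "q \<in> homogeneous 1"
  shows "a * q \<in> homogeneous x" "q * a \<in> homogeneous x"
  using homogeneous_mult[of a x q 1] homogeneous_mult[of q 1 a x] assms by simp_all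

lemma slice_coinvariant_mult:
  assumes f: "linear_functional sH f" and q: "q \<in> homogeneous 1"
  shows "slice f (q * b) = q * slice f b" and "slice f (b * q) = slice f b * q"
proof -
  have mult: "Vector_Spaces.linear sA sA (\<lambda>y. q * y)" "Vector_Spaces.linear sA sA (\<lambda>y. y * q)"
    by (simp_all add: linearity)
  have left: "bilin sA sH sA (\<lambda>a h. sum\<alpha> b (\<lambda>c g. sA (f (h * g)) (a * c)))"
    and right: "bilin sA sH sA (\<lambda>c g. sA (f (h * g)) (a * c))" for a h
    using f by (simp_all add: linearity)
  show "slice f (q * b) = q * slice f b"
    unfolding linear_image_slice[OF mult(1)]
    unfolding slice_def sum\<alpha>_mult[OF bilin_slice[OF f]] sum\<alpha>_homogeneous[OF q left] by simp
  show "slice f (b * q) = slice f b * q"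
    unfolding linear_image_slice[OF mult(2)]
    unfolding slice_def sum\<alpha>_mult[OF bilin_slice[OF f]] sum\<alpha>_homogeneous[OF q right] by simp
qed

subsection \<open>Invariant functionals\<close>

definition invariant :: "('a \<Rightarrow> 'k) \<Rightarrow> bool" where
  "invariant \<psi> \<longleftrightarrow> linear_functional sA \<psi> \<and> (\<forall>a. sum\<alpha> a (\<lambda>x h. sH (\<psi> x) h) = sH (\<psi> a) 1)"

lemma invariant_functional_iff: "invariant_functional sA sH sAH tAH \<alpha> \<psi> \<longleftrightarrow> invariant \<psi>"
proof (cases "linear_functional sA \<psi>")
  case True
  then have "bilin sA sH sH (\<lambda>x h. sH (\<psi> x) h)" by (simp add: linearity)
  from tlift_eq_sweedler[OF tensor_AH this] True show ?thesis
    by (simp add: invariant_def invariant_functional_def)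
qed (simp add: invariant_def invariant_functional_def)

lemma invariant_linear: "invariant \<psi> \<Longrightarrow> linear_functional sA \<psi>"
  by (simp add: invariant_def)

lemma invariant_sum:
  assumes "invariant \<psi>" and f: "Vector_Spaces.linear sH sX f"
  shows "sum\<alpha> a (\<lambda>x h. sX (\<psi> x) (f h)) = sX (\<psi> a) (f 1)"
proof -
  have "sum\<alpha> a (\<lambda>x h. sX (\<psi> x) (f h)) = f (sum\<alpha> a (\<lambda>x h. sH (\<psi> x) h))"
    using f by (simp add: linear_sweedler[OF f] Vector_Spaces.linear_iff)
  then show ?thesis using assms by (simp add: invariant_def Vector_Spaces.linear_iff)
qed

lemma invariant_lincomb:
  assumes "invariant \<psi>" and "invariant \<chi>"
  shows "invariant (\<lambda>a. c * \<psi> a + d * \<chi> a)"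
  unfolding invariant_def
proof (intro conjI allI)
  show "linear_functional sA (\<lambda>a. c * \<psi> a + d * \<chi> a)"
    using assms[THEN invariant_linear] by (simp add: linearity)
next
  fix a
  have "sum\<alpha> a (\<lambda>x h. sH (c * \<psi> x + d * \<chi> x) h) =
      sH c (sum\<alpha> a (\<lambda>x h. sH (\<psi> x) h)) + sH d (sum\<alpha> a (\<lambda>x h. sH (\<chi> x) h))"
    by (simp add: linearity)
  also have "\<dots> = sH c (sH (\<psi> a) 1) + sH d (sH (\<chi> a) 1)"
    using assms by (simp add: invariant_def)
  finally show "sum\<alpha> a (\<lambda>x h. sH (c * \<psi> x + d * \<chi> x) h) = sH (c * \<psi> a + d * \<chi> a) 1"
    by (simp add: linearity)
qed

lemma strong_invariance:
  assumes inv: "invariant \<psi>"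
  shows "sum\<alpha> b (\<lambda>y h. sH (\<psi> (a * y)) (S h)) = sum\<alpha> a (\<lambda>x h. sH (\<psi> (x * b)) h)"
proof -
  note \<psi> = invariant_linear[OF inv]
  have counit: "Vector_Spaces.linear sA sH (\<lambda>z. sH (\<psi> (x * z)) h)"
    and cancel: "Vector_Spaces.linear sH sH (\<lambda>k. sH c (h * k))"
    and shift: "trilin sA sH sH sH (\<lambda>z k l. sH (\<psi> (x * z)) (h * (k * S l)))"
    and product: "bilin sA sH sH (\<lambda>z k. sH (\<psi> z) (k * S l))"
    and right_mult: "Vector_Spaces.linear sH sH (\<lambda>k. k * S l)" for x h c l
    using \<psi> by (simp_all add: linearity)
  have "sum\<alpha> a (\<lambda>x h. sH (\<psi> (x * b)) h)
      = sum\<alpha> a (\<lambda>x h. sH (\<psi> (x * sum\<alpha> b (\<lambda>y l. sA (\<epsilon> l) y))) h)"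
    by (simp add: coaction_counit)
  also have "\<dots> = sum\<alpha> a (\<lambda>x h. sum\<alpha> b (\<lambda>y l. sH (\<psi> (x * y)) (h * sH (\<epsilon> l) 1)))"
    using \<psi> by (simp add: linear_sweedler[OF counit] linearity)
  also have "\<dots> = sum\<alpha> a (\<lambda>x h. sum\<alpha> b (\<lambda>y l. sum\<Delta> l (\<lambda>k m. sH (\<psi> (x * y)) (h * (k * S m)))))"
    by (simp add: linear_sweedler[OF cancel] flip: antipode_right)
  also have "\<dots> = sum\<alpha> a (\<lambda>x h. sum\<alpha> b (\<lambda>y l. sum\<alpha> y (\<lambda>z k. sH (\<psi> (x * z)) (h * (k * S l)))))"
    by (simp add: coassoc[OF shift])
  also have "\<dots> = sum\<alpha> b (\<lambda>y l. sum\<alpha> a (\<lambda>x h. sum\<alpha> y (\<lambda>z k. sH (\<psi> (x * z)) (h * k * S l))))"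
    by (subst sweedler_swap) (simp add: mult.assoc)
  also have "\<dots> = sum\<alpha> b (\<lambda>y l. sum\<alpha> (a * y) (\<lambda>z k. sH (\<psi> z) (k * S l)))"
    by (simp add: sum\<alpha>_mult[OF product])
  also have "\<dots> = sum\<alpha> b (\<lambda>y l. sH (\<psi> (a * y)) (S l))"
    by (simp add: invariant_sum[OF inv right_mult])
  finally show ?thesis ..
qed

lemma invariant_slice:
  assumes \<psi>: "invariant \<psi>" and f: "linear_functional sH f"
  shows "\<psi> (slice f a * b) = \<psi> (a * slice (\<lambda>h. f (S h)) b)"
proof -
  have mult: "linear_functional sA (\<lambda>x. \<psi> (x * b))" "linear_functional sA (\<lambda>x. \<psi> (a * x))"
    using invariant_linear[OF \<psi>] by (simp_all add: linearity)
  have "\<psi> (slice f a * b) = f (sum\<alpha> a (\<lambda>x h. sH (\<psi> (x * b)) h))"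
    using f by (simp add: linear_image_slice[OF mult(1)] linear_sweedler[OF f] linearity)
  also have "\<dots> = f (sum\<alpha> b (\<lambda>y h. sH (\<psi> (a * y)) (S h)))"
    by (simp add: strong_invariance[OF \<psi>])
  also have "\<dots> = \<psi> (a * slice (\<lambda>h. f (S h)) b)"
    using f by (simp add: linear_image_slice[OF mult(2)] linear_sweedler[OF f] linearity)
  finally show ?thesis .
qed

end

sublocale hopf \<subseteq> regular: hopf_comodule sH sHH sHHH tHH tHHH \<Delta> \<epsilon> S sH sHH sHHH tHH tHHH \<Delta>
  using hopf by unfold_locales (simp_all add: hopf_algebra_def comodule_algebra_def)

section \<open>Grouplike elements\<close>

context hopf
begin

definition grouplike :: "'h \<Rightarrow> bool" where
  "grouplike g \<longleftrightarrow> \<Delta> g = tHH g g \<and> \<epsilon> g = 1"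

lemma sum\<Delta>_grouplike: "grouplike g \<Longrightarrow> bilin sH sH sX \<beta> \<Longrightarrow> sum\<Delta> g \<beta> = \<beta> g g"
  using sweedler_tensor[OF tensor_HH] by (simp add: grouplike_def)

lemma grouplike_one: "grouplike 1"
  using hopf unfolding hopf_algebra_def grouplike_def by auto

lemma grouplike_right_inverse: "grouplike g \<Longrightarrow> g * S g = 1"
  and grouplike_left_inverse: "grouplike g \<Longrightarrow> S g * g = 1"
proof -
  assume g: "grouplike g"
  have "bilin sH sH sH (\<lambda>a b. a * S b)" "bilin sH sH sH (\<lambda>a b. S a * b)"
    by (simp_all add: linearity)
  from this[THEN sum\<Delta>_grouplike[OF g]] show "g * S g = 1" "S g * g = 1"
    using antipode_left[of g] antipode_right[of g] g
    by (simp_all add: grouplike_def vector_space.vector_space_assms(4)[OF vector_space_H])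
qed

lemma grouplike_antipode:
  assumes g: "grouplike g"
  shows "grouplike (S g)"
proof -
  note inverse = grouplike_right_inverse[OF g] grouplike_left_inverse[OF g]
  have left: "bilin sH sH sHH (\<lambda>a b. tHH (a * S g) (b * S g))"
    and middle: "bilin sH sH sHH (\<lambda>a b. tHH (c * a * S g) (d * b * S g))" for c d
    by (simp_all add: linearity)
  have "\<Delta> (S g) = sum\<Delta> (S g) tHH" by (simp add: sweedler_self[OF tensor_HH])
  also have "\<dots> = sum\<Delta> (S g) (\<lambda>a b. sum\<Delta> g (\<lambda>c d. tHH (a * c * S g) (b * d * S g)))"
    by (simp only: sum\<Delta>_grouplike[OF g middle]) (simp add: mult.assoc inverse)
  also have "\<dots> = sum\<Delta> (S g * g) (\<lambda>a b. tHH (a * S g) (b * S g))"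
    by (rule regular.sum\<alpha>_mult[OF left, symmetric])
  also have "\<dots> = tHH (S g) (S g)"
    by (simp add: inverse sum\<Delta>_grouplike[OF grouplike_one left])
  finally have "\<Delta> (S g) = tHH (S g) (S g)" .
  moreover have "\<epsilon> g * \<epsilon> (S g) = 1"
    using inverse(1) counit_mult[of g "S g"] counit_one by simp
  ultimately show ?thesis using g by (simp add: grouplike_def)
qed

lemma grouplike_antipode_antipode:
  assumes "grouplike g"
  shows "S (S g) = g"
proof -
  have "S (S g) = g * S g * S (S g)" by (simp add: grouplike_right_inverse[OF assms])
  also have "\<dots> = g"
    by (simp add: mult.assoc grouplike_right_inverse[OF grouplike_antipode[OF assms]])
  finally show ?thesis .
qed

end

section \<open>Integrals on Hopf algebras\<close>

definition (in hopf) relatively_invariant :: "('h \<Rightarrow> 'k) \<Rightarrow> 'h \<Rightarrow> bool" where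
  "relatively_invariant f x \<longleftrightarrow> linear_functional sH f \<and> (\<forall>h. regular.slice f h = sH (f h) x)"

lemma (in hopf_comodule) slice_homogeneous:
  assumes f: "relatively_invariant f x"
  shows "slice f a \<in> homogeneous x"
proof -
  have slice: "regular.slice f h = sH (f h) x" for h
    using f by (simp add: relatively_invariant_def)
  have shift: "trilin sA sH sH sAH (\<lambda>y k l. sAH (f l) (tAH y k))"
    and right: "Vector_Spaces.linear sH sAH (tAH y)"
    and left: "Vector_Spaces.linear sA sAH (\<lambda>y. tAH y x)" for y
    using f by (simp_all add: relatively_invariant_def linearity)
  have "\<alpha> (slice f a) = sum\<alpha> a (\<lambda>y h. sAH (f h) (sum\<alpha> y tAH))"
    by (simp add: linear_image_slice[OF linear_\<alpha>] sweedler_self[OF tensor_AH])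
  also have "\<dots> = sum\<alpha> a (\<lambda>y h. sum\<alpha> y (\<lambda>z k. sAH (f h) (tAH z k)))"
    by (simp only: scale_sweedler[OF vector_space_AH])
  also have "\<dots> = sum\<alpha> a (\<lambda>y h. sum\<Delta> h (\<lambda>k l. sAH (f l) (tAH y k)))"
    by (rule coassoc[OF shift])
  also have "\<dots> = sum\<alpha> a (\<lambda>y h. sAH (f h) (tAH y x))"
    by (simp only: regular.linear_image_slice[OF right, symmetric] slice) (simp add: linearity)
  also have "\<dots> = tAH (slice f a) x"
    by (simp add: linear_image_slice[OF left])
  finally show ?thesis by (simp add: homogeneous_def)
qed

lemma (in hopf) relatively_invariant_grouplike:
  assumes f: "relatively_invariant f g" "f b = 1"
  shows "grouplike g"
proof -
  have lin: "linear_functional sH f" and b: "regular.slice f b = g"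
    using f by (simp_all add: relatively_invariant_def linearity)
  have "\<Delta> g = tHH g g"
    using regular.slice_homogeneous[OF f(1), of b] b by (simp add: regular.homogeneous_def)
  moreover have "\<epsilon> g = f (sum\<Delta> b (\<lambda>k l. sH (\<epsilon> k) l))"
    unfolding b[symmetric] regular.linear_image_slice[OF linear_\<epsilon>] linear_sweedler[OF lin]
    using lin by (simp add: linearity)
  ultimately show ?thesis by (simp add: grouplike_def counit_left f(2))
qed

context hopf
begin

abbreviation right_integral :: "('h \<Rightarrow> 'k) \<Rightarrow> bool" where
  "right_integral \<equiv> regular.invariant"

abbreviation left_integral :: "('h \<Rightarrow> 'k) \<Rightarrow> bool" where
  "left_integral \<phi> \<equiv> relatively_invariant \<phi> 1"

lemma relatively_invariant_linear: "relatively_invariant f x \<Longrightarrow> linear_functional sH f"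
  by (simp add: relatively_invariant_def)

lemma relatively_invariant_sum:
  assumes "relatively_invariant \<phi> x" and f: "Vector_Spaces.linear sH sX f"
  shows "sum\<Delta> h (\<lambda>a b. sX (\<phi> b) (f a)) = sX (\<phi> h) (f x)"
  using assms regular.linear_image_slice[OF f, of \<phi> h]
  by (simp add: relatively_invariant_def Vector_Spaces.linear_iff)

lemma left_strong_invariance:
  assumes \<phi>: "left_integral \<phi>"
  shows "sum\<Delta> b (\<lambda>k l. sH (\<phi> (a * l)) k) = sum\<Delta> a (\<lambda>k l. sH (\<phi> (l * b)) (S k))"
proof -
  note lin = relatively_invariant_linear[OF \<phi>]
  have left_mult: "Vector_Spaces.linear sH sH (\<lambda>u. S k * u)"
    and product: "bilin sH sH sH (\<lambda>u v. sH (\<phi> v) (S k * u))"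
    and shift: "trilin sH sH sH sH (\<lambda>k p q. sum\<Delta> b (\<lambda>u v. sH (\<phi> (q * v)) (S k * (p * u))))"
    and cancel: "Vector_Spaces.linear sH sH (\<lambda>z. sH c (z * u))"
    and counit: "Vector_Spaces.linear sH sH (\<lambda>z. sH (\<phi> (z * v)) u)" for k c u v
    using lin by (simp_all add: linearity)
  have "sum\<Delta> a (\<lambda>k l. sH (\<phi> (l * b)) (S k)) =
      sum\<Delta> a (\<lambda>k l. sum\<Delta> (l * b) (\<lambda>u v. sH (\<phi> v) (S k * u)))"
    by (simp add: relatively_invariant_sum[OF \<phi> left_mult])
  also have "\<dots> = sum\<Delta> a (\<lambda>k l. sum\<Delta> l (\<lambda>p q. sum\<Delta> b (\<lambda>u v. sH (\<phi> (q * v)) (S k * (p * u)))))"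
    by (simp add: regular.sum\<alpha>_mult[OF product])
  also have "\<dots> = sum\<Delta> a (\<lambda>k l. sum\<Delta> k (\<lambda>k' p. sum\<Delta> b (\<lambda>u v. sH (\<phi> (l * v)) (S k' * (p * u)))))"
    by (rule regular.coassoc[OF shift, symmetric])
  also have "\<dots> = sum\<Delta> a (\<lambda>k l. sum\<Delta> b (\<lambda>u v. sum\<Delta> k (\<lambda>k' p. sH (\<phi> (l * v)) (S k' * p * u))))"
    by (subst sweedler_swap) (simp add: mult.assoc)
  also have "\<dots> = sum\<Delta> a (\<lambda>k l. sum\<Delta> b (\<lambda>u v. sH (\<phi> (sH (\<epsilon> k) l * v)) u))"
    by (simp only: linear_sweedler[OF cancel, symmetric] antipode_left)
      (use lin in \<open>simp add: linearity\<close>)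
  also have "\<dots> = sum\<Delta> b (\<lambda>u v. sum\<Delta> a (\<lambda>k l. sH (\<phi> (sH (\<epsilon> k) l * v)) u))"
    by (rule sweedler_swap)
  also have "\<dots> = sum\<Delta> b (\<lambda>u v. sH (\<phi> (a * v)) u)"
    by (simp add: counit_left flip: linear_sweedler[OF counit])
  finally show ?thesis ..
qed

lemma left_integral_times_right_integral:
  assumes \<phi>: "left_integral \<phi>" and \<psi>: "right_integral \<psi>"
  shows "\<phi> a * \<psi> b = sum\<Delta> a (\<lambda>k l. \<phi> (l * b) * \<psi> (S k))"
    and "\<phi> a * \<psi> b = sum\<Delta> b (\<lambda>k l. \<psi> (a * k) * \<phi> (S l))"
proof -
  note lin = relatively_invariant_linear[OF \<phi>] regular.invariant_linear[OF \<psi>]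
  have left_mult: "linear_functional sH (\<lambda>z. \<phi> (a * z))"
    and right_mult: "linear_functional sH (\<lambda>z. \<psi> (z * b))"
    using lin by (simp_all add: linearity)
  show "\<phi> a * \<psi> b = sum\<Delta> a (\<lambda>k l. \<phi> (l * b) * \<psi> (S k))"
    using arg_cong[OF left_strong_invariance[OF \<phi>], of \<psi> b a] lin
      regular.invariant_sum[OF \<psi> left_mult, of b]
    by (simp add: linear_sweedler[OF lin(2)] linearity)
  show "\<phi> a * \<psi> b = sum\<Delta> b (\<lambda>k l. \<psi> (a * k) * \<phi> (S l))"
    using arg_cong[OF regular.strong_invariance[OF \<psi>], of \<phi> b a] lin
      relatively_invariant_sum[OF \<phi> right_mult, of a]
    by (simp add: linear_sweedler[OF lin(1)] linearity)
qed

lemma right_integral_antipode_sum: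
  assumes \<phi>: "left_integral \<phi>" and \<psi>: "right_integral \<psi>"
  shows "sum\<Delta> h (\<lambda>a b. \<phi> a * \<psi> (S b * c)) = \<psi> (S h) * \<phi> c"
proof -
  note lin = relatively_invariant_linear[OF \<phi>] regular.invariant_linear[OF \<psi>]
  have shift: "trilin sH sH sH (*) (\<lambda>k l b. \<phi> (l * (S b * c)) * \<psi> (S k))"
    and cancel: "linear_functional sH (\<lambda>z. \<phi> (z * c) * d)"
    and counit: "linear_functional sH (\<lambda>z. \<phi> c * \<psi> (S z))" for d
    using lin by (simp_all add: linearity)
  have "\<phi> a * \<psi> (S b * c) = sum\<Delta> a (\<lambda>k l. \<phi> (l * (S b * c)) * \<psi> (S k))" for a b
    by (rule left_integral_times_right_integral(1)[OF \<phi> \<psi>])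
  then have "sum\<Delta> h (\<lambda>a b. \<phi> a * \<psi> (S b * c)) =
      sum\<Delta> h (\<lambda>a b. sum\<Delta> a (\<lambda>k l. \<phi> (l * (S b * c)) * \<psi> (S k)))"
    by simp
  also have "\<dots> = sum\<Delta> h (\<lambda>a b. sum\<Delta> b (\<lambda>k l. \<phi> (k * S l * c) * \<psi> (S a)))"
    by (subst regular.coassoc[OF shift]) (simp add: mult.assoc)
  also have "\<dots> = sum\<Delta> h (\<lambda>a b. \<phi> c * \<psi> (S (sH (\<epsilon> b) a)))"
    by (simp only: linear_sweedler[OF cancel, symmetric] antipode_right)
      (use lin in \<open>simp add: linearity\<close>)
  also have "\<dots> = \<phi> c * \<psi> (S h)"
    by (simp add: counit_right flip: linear_sweedler[OF counit])
  finally show ?thesis by (simp add: mult.commute)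
qed

lemma left_integral_antipode_sum:
  assumes \<phi>: "left_integral \<phi>" and \<psi>: "right_integral \<psi>"
  shows "sum\<Delta> h (\<lambda>a b. \<phi> (c * S a) * \<psi> b) = \<psi> c * \<phi> (S h)"
proof -
  note lin = relatively_invariant_linear[OF \<phi>] regular.invariant_linear[OF \<psi>]
  have shift: "trilin sH sH sH (*) (\<lambda>a k l. \<psi> (c * S a * k) * \<phi> (S l))"
    and cancel: "linear_functional sH (\<lambda>z. \<psi> (c * z) * d)"
    and counit: "linear_functional sH (\<lambda>z. \<psi> c * \<phi> (S z))" for d
    using lin by (simp_all add: linearity)
  have "sum\<Delta> h (\<lambda>a b. \<phi> (c * S a) * \<psi> b) =
      sum\<Delta> h (\<lambda>a b. sum\<Delta> b (\<lambda>k l. \<psi> (c * S a * k) * \<phi> (S l)))"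
    by (simp only: left_integral_times_right_integral(2)[OF \<phi> \<psi>])
  also have "\<dots> = sum\<Delta> h (\<lambda>a b. sum\<Delta> a (\<lambda>k l. \<psi> (c * (S k * l)) * \<phi> (S b)))"
    by (subst regular.coassoc[OF shift, symmetric]) (simp add: mult.assoc)
  also have "\<dots> = sum\<Delta> h (\<lambda>a b. \<psi> c * \<phi> (S (sH (\<epsilon> a) b)))"
    by (simp only: linear_sweedler[OF cancel, symmetric] antipode_left)
      (use lin in \<open>simp add: linearity\<close>)
  also have "\<dots> = \<psi> c * \<phi> (S h)"
    by (simp add: counit_left flip: linear_sweedler[OF counit])
  finally show ?thesis .
qed

lemma right_integral_faithful:
  assumes \<psi>: "right_integral \<psi>" and nonzero: "\<psi> b \<noteq> 0" and y: "\<And>c. \<psi> (y * c) = 0"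
  shows "y = 0"
proof -
  note lin = regular.invariant_linear[OF \<psi>]
  have shift: "trilin sH sH sH sH (\<lambda>u k l. sH (\<psi> (u * (S k * b))) l)"
    and cancel: "Vector_Spaces.linear sH sH (\<lambda>z. sH (\<psi> (z * b)) v)" for v
    using lin by (simp_all add: linearity)
  have scale_0: "sH 0 v = 0" for v
    by (simp add: vector_space.scale_eq_0_iff[OF vector_space_H])
  have "sum\<Delta> y (\<lambda>u v. sH (\<psi> (u * x)) v) = 0" for x
    using regular.strong_invariance[OF \<psi>, of x y] by (simp add: y scale_0)
  then have "0 = sum\<Delta> y (\<lambda>u v. sum\<Delta> v (\<lambda>k l. sH (\<psi> (u * (S k * b))) l))"
    by (intro sweedler_left_leg_zero[OF tensor_HH, where f = "\<lambda>u x. \<psi> (u * x)", symmetric])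
      (simp_all add: scale_0)
  also have "\<dots> = sum\<Delta> y (\<lambda>u v. sum\<Delta> u (\<lambda>k l. sH (\<psi> (k * S l * b)) v))"
    by (subst regular.coassoc[OF shift, symmetric]) (simp add: mult.assoc)
  also have "\<dots> = sH (\<psi> b) (sum\<Delta> y (\<lambda>u v. sH (\<epsilon> u) v))"
    by (simp only: linear_sweedler[OF cancel, symmetric] antipode_right)
      (use lin in \<open>simp add: linearity\<close>)
  finally have "sH (\<psi> b) y = 0" by (simp add: counit_left)
  then show ?thesis
    using nonzero by (simp add: vector_space.scale_eq_0_iff[OF vector_space_H])
qed

lemma left_integral_translate:
  assumes \<phi>: "left_integral \<phi>" and x: "grouplike x"
  shows "relatively_invariant (\<lambda>h. \<phi> (S x * h)) x"
  unfolding relatively_invariant_def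
proof (intro conjI allI)
  note lin = relatively_invariant_linear[OF \<phi>]
  show "linear_functional sH (\<lambda>h. \<phi> (S x * h))"
    using lin by (simp add: linearity)
  fix h
  have left_mult: "Vector_Spaces.linear sH sH (\<lambda>k. x * k)"
    and product: "bilin sH sH sH (\<lambda>k l. sH (\<phi> l) (x * k))"
    and diagonal: "bilin sH sH sH (\<lambda>k l. sum\<Delta> h (\<lambda>p q. sH (\<phi> (l * q)) (x * (k * p))))"
    using lin by (simp_all add: linearity)
  have "sH (\<phi> (S x * h)) x = sum\<Delta> (S x * h) (\<lambda>k l. sH (\<phi> l) (x * k))"
    using relatively_invariant_sum[OF \<phi> left_mult, of "S x * h"] by simp
  also have "\<dots> = sum\<Delta> h (\<lambda>p q. sH (\<phi> (S x * q)) (x * S x * p))"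
    unfolding regular.sum\<alpha>_mult[OF product] sum\<Delta>_grouplike[OF grouplike_antipode[OF x] diagonal]
    by (simp add: mult.assoc)
  finally show "regular.slice (\<lambda>h. \<phi> (S x * h)) h = sH (\<phi> (S x * h)) x"
    by (simp add: regular.slice_def grouplike_right_inverse[OF x])
qed

definition modular_element :: "'h \<Rightarrow> bool" where
  "modular_element g \<longleftrightarrow> grouplike g \<and> (\<forall>\<psi>. right_integral \<psi> \<longrightarrow> relatively_invariant \<psi> g)"

end

lemma (in hopf_comodule) invariant_comp_slice:
  assumes \<psi>: "right_integral \<psi>" and \<theta>: "linear_functional sA \<theta>"
  shows "invariant (\<lambda>a. \<theta> (slice \<psi> a))"
  unfolding invariant_def
proof (intro conjI allI)
  note lin = regular.invariant_linear[OF \<psi>]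
  show "linear_functional sA (\<lambda>a. \<theta> (slice \<psi> a))"
    using linear_slice[OF lin] \<theta> by (simp add: linearity)
  fix a
  have shift: "trilin sA sH sH sH (\<lambda>y k l. sH (\<psi> k * \<theta> y) l)"
    and ray: "Vector_Spaces.linear (*) sH (\<lambda>c. sH c v)"
    and scale: "Vector_Spaces.linear sH sH (sH c)" for c v
    using \<theta> lin by (simp_all add: linearity)
  have "sum\<alpha> a (\<lambda>x h. sH (\<theta> (slice \<psi> x)) h) = sum\<alpha> a (\<lambda>x h. sum\<alpha> x (\<lambda>y k. sH (\<psi> k * \<theta> y) h))"
    by (simp add: linear_image_slice[OF \<theta>] linear_sweedler[OF ray])
  also have "\<dots> = sum\<alpha> a (\<lambda>x h. sum\<Delta> h (\<lambda>k l. sH (\<psi> k) (sH (\<theta> x) l)))"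
    by (simp add: coassoc[OF shift] linearity)
  also have "\<dots> = sum\<alpha> a (\<lambda>x h. sH (\<psi> h * \<theta> x) 1)"
    by (simp only: regular.invariant_sum[OF \<psi> scale]) (simp add: linearity)
  also have "\<dots> = sH (\<theta> (slice \<psi> a)) 1"
    by (simp add: linear_image_slice[OF \<theta>] linear_sweedler[OF ray])
  finally show "sum\<alpha> a (\<lambda>x h. sH (\<theta> (slice \<psi> x)) h) = sH (\<theta> (slice \<psi> a)) 1" .
qed

locale hopf_integrals = hopf +
  assumes integrals: "has_invariant_functionals sH sHH tHH \<Delta>"
begin

lemma integrals_exist:
  obtains \<phi> \<psi> a b where "left_integral \<phi>" "right_integral \<psi>" "\<phi> a = 1" "\<psi> b = 1"
proof -
  obtain \<phi> \<psi> a b where \<phi>: "linear_functional sH \<phi>" and \<psi>: "linear_functional sH \<psi>"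
    and nonzero: "\<phi> a \<noteq> 0" "\<psi> b \<noteq> 0"
    and inv: "\<And>h. tlift sHH sH tHH (\<lambda>a b. sH (\<phi> b) a) (\<Delta> h) = sH (\<phi> h) 1"
      "\<And>h. tlift sHH sH tHH (\<lambda>a b. sH (\<psi> a) b) (\<Delta> h) = sH (\<psi> h) 1"
    using integrals unfolding has_invariant_functionals_def by blast
  have left: "bilin sH sH sH (\<lambda>a b. sH (\<phi> b) a)" and right: "bilin sH sH sH (\<lambda>a b. sH (\<psi> a) b)"
    using \<phi> \<psi> by (simp_all add: linearity)
  have "left_integral \<phi>" "right_integral \<psi>"
    using inv \<phi> \<psi>
    unfolding tlift_eq_sweedler[OF tensor_HH left] tlift_eq_sweedler[OF tensor_HH right]
    by (simp_all add: relatively_invariant_def regular.slice_def regular.invariant_def)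
  moreover have "\<phi> (sH (inverse (\<phi> a)) a) = 1" "\<psi> (sH (inverse (\<psi> b)) b) = 1"
    using \<phi> \<psi> nonzero by (simp_all add: Vector_Spaces.linear_iff)
  ultimately show thesis using that by blast
qed

lemma right_integral_unique:
  assumes \<psi>: "right_integral \<psi>" "\<psi> b \<noteq> 0" and \<psi>': "right_integral \<psi>'"
  obtains c where "\<psi>' = (\<lambda>h. c * \<psi> h)"
proof -
  obtain \<phi> a where \<phi>: "left_integral \<phi>" "\<phi> a = 1"
    using integrals_exist by metis
  obtain h where h: "\<psi> (S h) \<noteq> 0"
  proof (rule ccontr)
    assume "\<not> thesis"
    with that have "\<psi> (S k) = 0" for k by blast
    then have "\<phi> a * \<psi> b = 0"
      by (subst left_integral_times_right_integral(1)[OF \<phi>(1) \<psi>(1)]) simp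
    with \<phi>(2) \<psi>(2) show False by simp
  qed
  define y where "y = sum\<Delta> h (\<lambda>k l. sH (\<phi> k) (S l))"
  have y: "\<xi> (y * x) = \<xi> (S h) * \<phi> x" if \<xi>: "right_integral \<xi>" for \<xi> x
  proof -
    have right_mult: "linear_functional sH (\<lambda>z. \<xi> (z * x))"
      using regular.invariant_linear[OF \<xi>] by (simp add: linearity)
    show ?thesis
      unfolding y_def linear_sweedler[OF right_mult]
      unfolding right_integral_antipode_sum[OF \<phi>(1) \<xi>, symmetric]
      using regular.invariant_linear[OF \<xi>] by (simp add: linearity)
  qed
  have "y \<noteq> 0"
    using y[OF \<psi>(1), of a] h \<phi>(2) linear_image_0[OF regular.invariant_linear[OF \<psi>(1)]] by auto
  define c where "c = \<psi>' (S h) / \<psi> (S h)"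
  define \<chi> where "\<chi> x = 1 * \<psi>' x + (- c) * \<psi> x" for x
  have \<chi>: "right_integral \<chi>"
    unfolding \<chi>_def by (rule regular.invariant_lincomb[OF \<psi>' \<psi>(1)])
  have "\<chi> (S h) = 0" using h by (simp add: \<chi>_def c_def)
  then have "\<chi> (y * x) = 0" for x by (simp add: y[OF \<chi>])
  then have "\<chi> x = 0" for x using right_integral_faithful[OF \<chi>, of x y] \<open>y \<noteq> 0\<close> by blast
  then have "\<psi>' = (\<lambda>h. c * \<psi> h)" by (simp add: \<chi>_def fun_eq_iff)
  then show thesis by (rule that)
qed

text \<open>By uniqueness \<open>h \<mapsto> \<theta>(h\<^sub>1) \<psi>(h\<^sub>2)\<close> is a multiple of \<open>\<psi>\<close> for every functional \<open>\<theta>\<close>.\<close>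
lemma modular_element_exists: "\<exists>g. modular_element g"
proof -
  obtain \<psi> b where \<psi>: "right_integral \<psi>" "\<psi> b = 1"
    using integrals_exist by metis
  define g where "g = regular.slice \<psi> b"
  have slice: "regular.slice \<psi> h = sH (\<psi> h) g" for h
  proof (rule linear_functional_eqI[OF vector_space_H])
    fix \<theta> assume \<theta>: "linear_functional sH \<theta>"
    from \<psi>(2) obtain c where c: "(\<lambda>h. \<theta> (regular.slice \<psi> h)) = (\<lambda>h. c * \<psi> h)"
      using right_integral_unique[OF \<psi>(1) _ regular.invariant_comp_slice[OF \<psi>(1) \<theta>], of b] by auto
    then have "\<theta> (regular.slice \<psi> h) = \<psi> h * \<theta> g"
      unfolding g_def by (metis \<psi>(2) mult.commute mult.right_neutral)
    then show "\<theta> (regular.slice \<psi> h) = \<theta> (sH (\<psi> h) g)"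
      using \<theta> by (simp add: Vector_Spaces.linear_iff)
  qed
  then have "relatively_invariant \<psi> g"
    using regular.invariant_linear[OF \<psi>(1)] by (simp add: relatively_invariant_def)
  then have "grouplike g" using \<psi>(2) by (rule relatively_invariant_grouplike)
  moreover have "relatively_invariant \<psi>' g" if \<psi>': "right_integral \<psi>'" for \<psi>'
  proof -
    obtain c where c: "\<psi>' = (\<lambda>h. c * \<psi> h)"
      using right_integral_unique[OF \<psi>(1) _ \<psi>', of b] \<psi>(2) by auto
    have "regular.slice \<psi>' h = sH c (regular.slice \<psi> h)" for h
      by (simp add: c regular.slice_def linearity)
    then show ?thesis
      using regular.invariant_linear[OF \<psi>']
      by (simp add: relatively_invariant_def slice c linearity)
  qed
  ultimately show ?thesis by (auto simp: modular_element_def)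
qed

lemma left_integral_comp_antipode:
  assumes \<phi>: "left_integral \<phi>"
  shows "right_integral (\<lambda>h. \<phi> (S h))"
proof -
  note lin = relatively_invariant_linear[OF \<phi>]
  obtain \<psi> b where \<psi>: "right_integral \<psi>" "\<psi> b = 1"
    using integrals_exist by metis
  obtain g where g: "relatively_invariant \<psi> g"
    using modular_element_exists \<psi>(1) by (auto simp: modular_element_def)
  have "\<phi> (S h) = \<phi> (b * S g) * \<psi> h" for h
  proof -
    have translate: "linear_functional sH (\<lambda>x. \<phi> (b * S x))"
      using lin by (simp add: linearity)
    have "\<phi> (S h) = sum\<Delta> h (\<lambda>k l. \<phi> (b * S k) * \<psi> l)"
      by (simp add: left_integral_antipode_sum[OF \<phi> \<psi>(1)] \<psi>(2))
    also have "\<dots> = \<psi> h * \<phi> (b * S g)"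
      using relatively_invariant_sum[OF g translate, of h] by (simp add: mult.commute)
    finally show ?thesis by (simp add: mult.commute)
  qed
  with regular.invariant_lincomb[OF \<psi>(1,1), of "\<phi> (b * S g)" 0] show ?thesis by simp
qed

end

section \<open>Galois objects\<close>

context hopf_comodule
begin

definition galois_map :: "'a \<Rightarrow> 'a \<Rightarrow> 'ah" where
  "galois_map a b = tmult sAH tAH (tAH a 1) (\<alpha> b)"

lemma galois_map_eq: "galois_map a b = sum\<alpha> b (\<lambda>z l. tAH (a * z) l)"
proof -
  have "bilin sA sH sAH (\<lambda>y k. sum\<alpha> b (\<lambda>z l. tAH (y * z) (k * l)))" by (simp add: linearity)
  from sweedler_tensor[OF tensor_AH this, of a 1] show ?thesis
    by (simp add: galois_map_def tmult_eq_sweedler[OF tensor_AH algebra_A algebra_H])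
qed

lemma bilin_galois_map: "bilin sA sA sAH galois_map"
proof -
  have "bilin sA sH sAH (\<lambda>z l. tAH (a * z) l)" for a by (simp add: linearity)
  from linear_sum\<alpha>[OF this] have "Vector_Spaces.linear sA sAH (galois_map a)" for a
    by (simp add: galois_map_eq[abs_def])
  moreover have "Vector_Spaces.linear sA sAH (\<lambda>a. galois_map a b)" for b
    by (simp add: galois_map_eq linearity)
  ultimately show ?thesis by (simp add: bilin_def)
qed

text \<open>Apply \<open>f\<close> to the second leg of a preimage of \<open>c \<otimes> h\<close> under the Galois map.\<close>
lemma galois_map_surj_expansion:
  assumes T: "is_tensor_product sA sA sAA tAA" and surj: "surj (tlift sAA sAH tAA galois_map)"
    and f: "linear_functional sH f" "f h = 1"
  obtains z where "c = sweedler sA tAA z (\<lambda>d a. d * slice f a)"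
proof -
  define L where "L u = sweedler sH tAH u (\<lambda>y k. sA (f k) y)" for u
  have L: "Vector_Spaces.linear sAH sA L"
    unfolding L_def by (rule linear_sweedler_left[OF tensor_AH bilin_slice[OF f(1)]])
  have L_tensor: "L (tAH y k) = sA (f k) y" for y k
    unfolding L_def by (rule sweedler_tensor[OF tensor_AH bilin_slice[OF f(1)]])
  have L_galois: "L (galois_map d a) = d * slice f a" for d a
  proof -
    have "Vector_Spaces.linear sA sA ((*) d)" by (simp add: linearity)
    then show ?thesis
      by (simp add: galois_map_eq linear_sweedler[OF L] L_tensor linear_image_slice)
  qed
  obtain z where z: "tAH c h = tlift sAA sAH tAA galois_map z"
    using surjD[OF surj] by blast
  have "c = L (sweedler sA tAA z galois_map)"
    by (simp add: L_tensor f(2) linearity flip: z tlift_eq_sweedler[OF T bilin_galois_map])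
  also have "\<dots> = sweedler sA tAA z (\<lambda>d a. d * slice f a)"
    by (simp add: linear_sweedler[OF L] L_galois)
  finally show thesis by (rule that)
qed

end

locale galois = hopf_integrals sH sHH sHHH tHH tHHH \<Delta> \<epsilon> S +
  hopf_comodule sH sHH sHHH tHH tHHH \<Delta> \<epsilon> S sA sAH sAHH tAH tAHH \<alpha>
  for sH :: "'k::field \<Rightarrow> 'h::ring_1 \<Rightarrow> 'h"
    and sHH :: "'k \<Rightarrow> 'hh::ab_group_add \<Rightarrow> 'hh"
    and sHHH :: "'k \<Rightarrow> 'hhh::ab_group_add \<Rightarrow> 'hhh"
    and tHH :: "'h \<Rightarrow> 'h \<Rightarrow> 'hh" and tHHH :: "'hh \<Rightarrow> 'h \<Rightarrow> 'hhh"
    and \<Delta> :: "'h \<Rightarrow> 'hh" and \<epsilon> :: "'h \<Rightarrow> 'k" and S :: "'h \<Rightarrow> 'h"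
    and sA :: "'k \<Rightarrow> 'a::ring \<Rightarrow> 'a"
    and sAH :: "'k \<Rightarrow> 'ah::ab_group_add \<Rightarrow> 'ah"
    and sAHH :: "'k \<Rightarrow> 'ahh::ab_group_add \<Rightarrow> 'ahh"
    and tAH :: "'a \<Rightarrow> 'h \<Rightarrow> 'ah" and tAHH :: "'ah \<Rightarrow> 'h \<Rightarrow> 'ahh"
    and \<alpha> :: "'a \<Rightarrow> 'ah" +
  fixes sAA :: "'k \<Rightarrow> 'aa::ab_group_add \<Rightarrow> 'aa" and tAA :: "'a \<Rightarrow> 'a \<Rightarrow> 'aa"
    and I :: "'i set" and p :: "'i \<Rightarrow> 'a"
  assumes galois: "galois_object sA sH sHH sAH sAHH sAA tHH tAH tAHH tAA \<Delta> \<epsilon> \<alpha> I p"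
begin

sublocale A: vector_space sA by (rule vector_space_A)

lemmas mult_scale = algebra_scale_mult[OF algebra_A]

lemma idempotent: "i \<in> I \<Longrightarrow> p i * p i = p i"
  and idempotent_nonzero: "i \<in> I \<Longrightarrow> p i \<noteq> 0"
  and orthogonal: "i \<in> I \<Longrightarrow> j \<in> I \<Longrightarrow> i \<noteq> j \<Longrightarrow> p i * p j = 0"
  and coinvariants_span: "homogeneous 1 = A.span (p ` I)"
  using galois unfolding galois_object_def coinvariants_eq_homogeneous by auto

lemma idempotent_mult: "i \<in> I \<Longrightarrow> p i * (p i * a) = p i * a"
  by (simp add: idempotent flip: mult.assoc)

lemma idempotent_coinvariant: "i \<in> I \<Longrightarrow> p i \<in> homogeneous 1"
  unfolding coinvariants_span by (rule A.span_base) auto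

lemma slice_mult_nonzero:
  assumes f: "linear_functional sH f" "f h = 1" and "c * q \<noteq> 0"
  obtains d a where "d * (slice f a * q) \<noteq> 0"
proof (rule ccontr)
  assume "\<not> thesis"
  with that have zero: "d * (slice f a * q) = 0" for d a by blast
  have T: "is_tensor_product sA sA sAA tAA" and surj: "surj (tlift sAA sAH tAA galois_map)"
    using galois by (simp_all add: galois_object_def galois_map_def[abs_def] Let_def)
  obtain z where z: "c = sweedler sA tAA z (\<lambda>d a. d * slice f a)"
    using galois_map_surj_expansion[OF T surj f] by blast
  have "Vector_Spaces.linear sA sA (\<lambda>x. x * q)" by (simp add: linearity)
  from linear_sweedler[OF this, of sA tAA z] have "c * q = 0"
    by (simp add: z mult.assoc zero)
  with \<open>c * q \<noteq> 0\<close> show False by simp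
qed

lemma homogeneous_mult_nonzero:
  assumes x: "grouplike x" and "c * q \<noteq> 0"
  obtains d y where "y \<in> homogeneous x" "d * (y * q) \<noteq> 0"
proof -
  obtain \<phi> h where \<phi>: "left_integral \<phi>" "\<phi> h = 1" using integrals_exist by metis
  note \<phi>x = left_integral_translate[OF \<phi>(1) x]
  have "\<phi> (S x * (x * h)) = 1"
    by (simp add: \<phi>(2) grouplike_left_inverse[OF x] flip: mult.assoc)
  from slice_mult_nonzero[OF relatively_invariant_linear[OF \<phi>x] this \<open>c * q \<noteq> 0\<close>]
  obtain d a where "d * (slice (\<lambda>k. \<phi> (S x * k)) a * q) \<noteq> 0" .
  with slice_homogeneous[OF \<phi>x] show thesis by (rule that)
qed

lemma idempotent_mult_nonzero:
  assumes "c * q \<noteq> 0"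
  obtains m where "m \<in> I" "p m * q \<noteq> 0"
proof (rule ccontr)
  assume "\<not> thesis"
  with that have zero: "p m * q = 0" if "m \<in> I" for m using \<open>m \<in> I\<close> by blast
  obtain d y where "y \<in> homogeneous 1" and nonzero: "d * (y * q) \<noteq> 0"
    using homogeneous_mult_nonzero[OF grouplike_one assms] .
  then have "y \<in> A.span (p ` I)" by (simp only: coinvariants_span)
  then have "y * q = 0"
    by (induction rule: A.span_induct_alt) (auto simp: distrib_right mult_scale zero)
  with nonzero show False by simp
qed

lemma coinvariant_mult_idempotent:
  assumes "b \<in> homogeneous 1" and i: "i \<in> I"
  obtains c where "b * p i = sA c (p i)" "p i * b = sA c (p i)"
proof -
  from assms(1) have "b \<in> A.span (p ` I)" by (simp only: coinvariants_span)
  then have "\<exists>c. b * p i = sA c (p i) \<and> p i * b = sA c (p i)"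
  proof (induction rule: A.span_induct_alt)
    case base
    show ?case by (rule exI[of _ 0]) simp
  next
    case (step k x y)
    then obtain j c where j: "j \<in> I" "x = p j" and c: "y * p i = sA c (p i)" "p i * y = sA c (p i)"
      by blast
    then show ?case
      using idempotent[OF i] orthogonal[OF i j(1)] orthogonal[OF j(1) i]
      by (intro exI[of _ "(if j = i then k else 0) + c"])
        (auto simp: distrib_left distrib_right mult_scale A.scale_left_distrib)
  qed
  with that show thesis by blast
qed

subsection \<open>The permutation attached to a grouplike element\<close>

definition links :: "'h \<Rightarrow> 'a \<Rightarrow> 'i \<Rightarrow> 'i \<Rightarrow> bool" where
  "links x w l m \<longleftrightarrow>
     l \<in> I \<and> m \<in> I \<and> w \<in> homogeneous x \<and> w \<noteq> 0 \<and> p l * w = w \<and> w * p m = w"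

lemma links_inverse:
  assumes x: "grouplike x" and "links x w l m"
  obtains v where "links (S x) v m l" "v * w = p m" "w * v = p l"
proof -
  have l: "l \<in> I" and m: "m \<in> I" and w: "w \<in> homogeneous x" "w \<noteq> 0" "p l * w = w" "w * p m = w"
    using \<open>links x w l m\<close> by (simp_all add: links_def)
  from w(2,3) have "p l * w \<noteq> 0" by simp
  then obtain y where y: "y \<in> homogeneous (S x)" "y * w \<noteq> 0"
    using homogeneous_mult_nonzero[OF grouplike_antipode[OF x]] by (metis mult_zero_right)
  have "y * w \<in> homogeneous 1"
    using homogeneous_mult[OF y(1) w(1)] by (simp add: grouplike_left_inverse[OF x])
  then obtain c where "y * w * p m = sA c (p m)" using coinvariant_mult_idempotent[OF _ m] by blast
  then have c: "y * w = sA c (p m)" by (simp add: mult.assoc w(4))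
  define v where "v = sA (inverse c) (p m * y * p l)"
  have v: "v \<in> homogeneous (S x)"
    unfolding v_def
    by (intro homogeneous_scale homogeneous_coinvariant_mult idempotent_coinvariant y(1) l m)
  have "c \<noteq> 0" using y(2) c by auto
  then have vw: "v * w = p m" by (simp add: v_def mult_scale mult.assoc w(3) c idempotent[OF m])
  have "w * v \<in> homogeneous 1"
    using homogeneous_mult[OF w(1) v] by (simp add: grouplike_right_inverse[OF x])
  then obtain k where "p l * (w * v) = sA k (p l)"
    using coinvariant_mult_idempotent[OF _ l] by blast
  then have k: "w * v = sA k (p l)" using w(3) by (simp flip: mult.assoc)
  have "w = w * (v * w)" by (simp add: vw w(4))
  also have "\<dots> = sA k w" by (simp add: k mult_scale w(3) flip: mult.assoc)
  finally have "sA (k - 1) w = 0" by (simp add: A.scale_left_diff_distrib)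
  with w(2) k have "w * v = p l" by simp
  moreover have "v \<noteq> 0" using vw idempotent_nonzero[OF m] by auto
  with l m v have "links (S x) v m l"
    by (simp add: links_def v_def mult_scale mult.assoc idempotent idempotent_mult)
  ultimately show thesis using vw that by blast
qed

lemma links_row:
  assumes x: "grouplike x" and w: "links x w l m" and y: "y \<in> homogeneous x"
  shows "\<exists>c. p l * y = sA c w"
proof -
  obtain v where v: "links (S x) v m l" "w * v = p l"
    using links_inverse[OF x w] by blast
  then have "v * y \<in> homogeneous 1"
    using homogeneous_mult[of v "S x" y x] y by (simp add: links_def grouplike_left_inverse[OF x])
  moreover have "m \<in> I" using w by (simp add: links_def)
  ultimately obtain c where "p m * (v * y) = sA c (p m)" using coinvariant_mult_idempotent by blast
  then have "v * y = sA c (p m)" using v(1) by (simp add: links_def flip: mult.assoc)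
  then have "p l * y = sA c w" using w by (simp add: links_def mult.assoc mult_scale flip: v(2))
  then show ?thesis ..
qed

abbreviation linked :: "'h \<Rightarrow> 'i \<Rightarrow> 'i \<Rightarrow> bool" where
  "linked x l m \<equiv> \<exists>w. links x w l m"

lemma linked_antipode: "grouplike x \<Longrightarrow> linked x l m \<Longrightarrow> linked (S x) m l"
  using links_inverse by metis

lemma linked_left_exists:
  assumes x: "grouplike x" and m: "m \<in> I"
  shows "\<exists>l. linked x l m"
proof -
  have "p m * p m \<noteq> 0" using m by (simp add: idempotent idempotent_nonzero)
  then obtain d y where y: "y \<in> homogeneous x" "d * (y * p m) \<noteq> 0"
    using homogeneous_mult_nonzero[OF x] by blast
  obtain l where l: "l \<in> I" "p l * (y * p m) \<noteq> 0" using idempotent_mult_nonzero[OF y(2)] .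
  have "p l * y * p m \<in> homogeneous x"
    by (intro homogeneous_coinvariant_mult idempotent_coinvariant y(1) l(1) m)
  then have "links x (p l * y * p m) l m"
    using l m by (auto simp: links_def mult.assoc idempotent idempotent_mult)
  then show ?thesis by blast
qed

lemma linked_right_exists:
  assumes x: "grouplike x" and l: "l \<in> I"
  shows "\<exists>m. linked x l m"
proof -
  obtain m where "linked (S x) m l" using linked_left_exists[OF grouplike_antipode[OF x] l] by blast
  from linked_antipode[OF grouplike_antipode[OF x] this] show ?thesis
    by (auto simp: grouplike_antipode_antipode[OF x])
qed

lemma linked_right_unique:
  assumes x: "grouplike x" and "linked x l m" and "linked x l m'"
  shows "m = m'"
proof (rule ccontr)
  assume "m \<noteq> m'"
  obtain w w' where w: "links x w l m" and w': "links x w' l m'" using assms(2,3) by blast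
  obtain c where "w' = sA c w" using links_row[OF x w, of w'] w' by (auto simp: links_def)
  with w have "w' = w' * p m" by (simp add: links_def mult_scale)
  moreover have "w' * p m * p m' = 0"
    using orthogonal[of m m'] \<open>m \<noteq> m'\<close> w w' by (simp add: links_def mult.assoc)
  ultimately show False using w' by (auto simp: links_def)
qed

lemma linked_left_unique:
  assumes x: "grouplike x" and "linked x l m" and "linked x l' m"
  shows "l = l'"
  using linked_right_unique[OF grouplike_antipode[OF x]] assms(2,3)[THEN linked_antipode[OF x]] .

lemma linked_permutation:
  assumes x: "grouplike x"
  obtains \<mu> where "bij_betw \<mu> I I" "\<And>l. l \<in> I \<Longrightarrow> linked x l (\<mu> l)"
proof -
  obtain \<mu> where \<mu>: "linked x l (\<mu> l)" if "l \<in> I" for l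
    using linked_right_exists[OF x] by metis
  have "inj_on \<mu> I"
    using \<mu> linked_left_unique[OF x] by (metis inj_onI)
  moreover have "\<mu> ` I = I"
  proof
    show "\<mu> ` I \<subseteq> I" using \<mu> by (auto simp: links_def)
    show "I \<subseteq> \<mu> ` I"
    proof
      fix m assume "m \<in> I"
      then obtain l where l: "linked x l m" using linked_left_exists[OF x] by blast
      then have "l \<in> I" by (auto simp: links_def)
      with linked_right_unique[OF x l \<mu>] show "m \<in> \<mu> ` I" by blast
    qed
  qed
  ultimately show thesis using that \<mu> by (simp add: bij_betw_def)
qed

subsection \<open>Corners of invariant functionals\<close>

lemma slice_local_unit:
  assumes \<phi>: "left_integral \<phi>" "\<phi> h = 1" and i: "i \<in> I"
  obtains a where "slice \<phi> a * p i = p i"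
proof -
  note lin = relatively_invariant_linear[OF \<phi>(1)]
  have "p i * p i \<noteq> 0" using i by (simp add: idempotent idempotent_nonzero)
  then obtain a where a: "slice \<phi> a * p i \<noteq> 0"
    using slice_mult_nonzero[OF lin \<phi>(2)] by (metis mult_zero_right)
  obtain c where c: "slice \<phi> a * p i = sA c (p i)"
    using coinvariant_mult_idempotent[OF slice_homogeneous[OF \<phi>(1)] i] by blast
  with a have "slice \<phi> (sA (inverse c) a) * p i = p i"
    using linear_slice[OF lin] by (auto simp: Vector_Spaces.linear_iff mult_scale)
  then show thesis by (rule that)
qed

lemma invariant_row:
  assumes g: "modular_element g" and "linked g i m"
  obtains \<kappa> d where "\<And>\<psi> b. invariant \<psi> \<Longrightarrow> \<psi> (p i * b) = \<kappa> b * \<psi> d"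
    and "\<And>j b. j \<in> I \<Longrightarrow> \<kappa> (b * p j) = (if j = m then \<kappa> b else 0)"
proof -
  obtain w where w: "links g w i m" using \<open>linked g i m\<close> ..
  then have i: "i \<in> I" by (simp add: links_def)
  obtain \<phi> h where \<phi>: "left_integral \<phi>" "\<phi> h = 1" using integrals_exist by metis
  define R where "R = slice (\<lambda>h. \<phi> (S h))"
  have \<phi>S: "relatively_invariant (\<lambda>h. \<phi> (S h)) g"
    using g left_integral_comp_antipode[OF \<phi>(1)] by (simp add: modular_element_def)
  note R_mult = slice_coinvariant_mult[OF relatively_invariant_linear[OF \<phi>S], folded R_def,
      OF idempotent_coinvariant]
  have "\<exists>c. p i * R b = sA c w" for b
    using g unfolding R_def modular_element_def
    by (intro links_row[OF _ w] slice_homogeneous[OF \<phi>S]) simp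
  then obtain \<kappa> where \<kappa>: "\<And>b. p i * R b = sA (\<kappa> b) w" by metis
  obtain a where a: "slice \<phi> a * p i = p i" using slice_local_unit[OF \<phi> i] .
  show thesis
  proof (rule that)
    fix \<psi> b assume \<psi>: "invariant \<psi>"
    have "\<psi> (p i * b) = \<psi> (slice \<phi> a * (p i * b))" by (simp add: a flip: mult.assoc)
    also have "\<dots> = \<psi> (a * R (p i * b))"
      unfolding R_def by (rule invariant_slice[OF \<psi> relatively_invariant_linear[OF \<phi>(1)]])
    also have "\<dots> = \<kappa> b * \<psi> (a * w)"
      using invariant_linear[OF \<psi>]
      by (simp add: R_mult(1)[OF i] \<kappa> mult_scale Vector_Spaces.linear_iff)
    finally show "\<psi> (p i * b) = \<kappa> b * \<psi> (a * w)" .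
  next
    fix j b assume j: "j \<in> I"
    have "w * p j = (if j = m then w else 0)"
      using w orthogonal[OF _ j] unfolding links_def by (metis mult.assoc mult_zero_right)
    moreover have "p i * R (b * p j) = sA (\<kappa> b) (w * p j)"
      by (simp add: R_mult(2)[OF j] \<kappa> mult_scale flip: mult.assoc)
    ultimately show "\<kappa> (b * p j) = (if j = m then \<kappa> b else 0)"
      using w by (auto simp: \<kappa> links_def split: if_splits)
  qed
qed

lemma corner_factorization:
  obtains \<mu> \<kappa> d where "bij_betw \<mu> I I"
    and "\<And>\<psi> i b. invariant \<psi> \<Longrightarrow> i \<in> I \<Longrightarrow> \<psi> (p i * b) = \<kappa> i b * \<psi> (d i)"
    and "\<And>\<psi> i j b. invariant \<psi> \<Longrightarrow> i \<in> I \<Longrightarrow> j \<in> I \<Longrightarrow>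
      corner p \<psi> i j b = (if j = \<mu> i then \<kappa> i b * \<psi> (d i) else 0)"
proof -
  obtain g where g: "modular_element g" using modular_element_exists ..
  obtain \<mu> where \<mu>: "bij_betw \<mu> I I" "\<And>i. i \<in> I \<Longrightarrow> linked g i (\<mu> i)"
    using linked_permutation g unfolding modular_element_def by blast
  have "\<exists>\<kappa> d. (\<forall>\<psi> b. invariant \<psi> \<longrightarrow> \<psi> (p i * b) = \<kappa> b * \<psi> d) \<and>
      (\<forall>j\<in>I. \<forall>b. \<kappa> (b * p j) = (if j = \<mu> i then \<kappa> b else 0))" if "i \<in> I" for i
    using invariant_row[OF g \<mu>(2)[OF that]] by metis
  then obtain \<kappa> d where row: "\<And>\<psi> i b. invariant \<psi> \<Longrightarrow> i \<in> I \<Longrightarrow> \<psi> (p i * b) = \<kappa> i b * \<psi> (d i)"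
    and column: "\<And>i j b. i \<in> I \<Longrightarrow> j \<in> I \<Longrightarrow> \<kappa> i (b * p j) = (if j = \<mu> i then \<kappa> i b else 0)"
    by metis
  have "corner p \<psi> i j b = (if j = \<mu> i then \<kappa> i b * \<psi> (d i) else 0)"
    if "invariant \<psi>" "i \<in> I" "j \<in> I" for \<psi> i j b
    using row[OF that(1,2), of "b * p j"] column[OF that(2,3)] by (simp add: corner_def mult.assoc)
  with \<mu>(1) row show thesis by (rule that)
qed

end

theorem mainTheorem18:
  fixes sA :: "'k::field \<Rightarrow> 'a::ring \<Rightarrow> 'a"
    and sH :: "'k \<Rightarrow> 'h::ring_1 \<Rightarrow> 'h"
    and sHH :: "'k \<Rightarrow> 'hh::ab_group_add \<Rightarrow> 'hh"
    and sHHH :: "'k \<Rightarrow> 'hhh::ab_group_add \<Rightarrow> 'hhh"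
    and sAH :: "'k \<Rightarrow> 'ah::ab_group_add \<Rightarrow> 'ah"
    and sAHH :: "'k \<Rightarrow> 'ahh::ab_group_add \<Rightarrow> 'ahh"
    and sAA :: "'k \<Rightarrow> 'aa::ab_group_add \<Rightarrow> 'aa"
    and tHH :: "'h \<Rightarrow> 'h \<Rightarrow> 'hh" and tHHH :: "'hh \<Rightarrow> 'h \<Rightarrow> 'hhh"
    and tAH :: "'a \<Rightarrow> 'h \<Rightarrow> 'ah" and tAHH :: "'ah \<Rightarrow> 'h \<Rightarrow> 'ahh"
    and tAA :: "'a \<Rightarrow> 'a \<Rightarrow> 'aa"
    and \<Delta> :: "'h \<Rightarrow> 'hh" and \<epsilon> :: "'h \<Rightarrow> 'k" and S :: "'h \<Rightarrow> 'h"
    and \<alpha> :: "'a \<Rightarrow> 'ah"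
    and I :: "'i set" and p :: "'i \<Rightarrow> 'a"
    and \<psi>A :: "'a \<Rightarrow> 'k"
  assumes "hopf_algebra sH sHH sHHH tHH tHHH \<Delta> \<epsilon> S"
    and "has_invariant_functionals sH sHH tHH \<Delta>"
    and "galois_object sA sH sHH sAH sAHH sAA tHH tAH tAHH tAA \<Delta> \<epsilon> \<alpha> I p"
    and "invariant_functional sA sH sAH tAH \<alpha> \<psi>A"
    and "left_complete I p \<psi>A"
  shows "\<exists>\<mu>. bij_betw \<mu> I I \<and>
           (\<forall>i\<in>I. \<forall>j\<in>I. corner p \<psi>A i j \<noteq> (\<lambda>_. 0) \<longleftrightarrow> j = \<mu> i) \<and>
           (\<forall>\<psi>'. invariant_functional sA sH sAH tAH \<alpha> \<psi>' \<longrightarrow>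
              (\<exists>c :: 'i \<Rightarrow> 'k. \<forall>i\<in>I. \<forall>j\<in>I. \<forall>a.
                 corner p \<psi>' i j a = (if j = \<mu> i then 1 else 0) * c i * corner p \<psi>A i j a))"
proof -
  note comodule = assms(3)[unfolded galois_object_def, THEN conjunct1]
  interpret galois sH sHH sHHH tHH tHHH \<Delta> \<epsilon> S sA sAH sAHH tAH tAHH \<alpha> sAA tAA I p
    by unfold_locales (fact assms(1-3) comodule)+
  obtain \<mu> \<kappa> d where \<mu>: "bij_betw \<mu> I I"
    and row: "\<And>\<psi> i b. invariant \<psi> \<Longrightarrow> i \<in> I \<Longrightarrow> \<psi> (p i * b) = \<kappa> i b * \<psi> (d i)"
    and corner: "\<And>\<psi> i j b. invariant \<psi> \<Longrightarrow> i \<in> I \<Longrightarrow> j \<in> I \<Longrightarrow>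
      corner p \<psi> i j b = (if j = \<mu> i then \<kappa> i b * \<psi> (d i) else 0)"
    using corner_factorization by blast
  have \<psi>A: "invariant \<psi>A" using assms(4) by (simp add: invariant_functional_iff)
  have nonzero: "\<psi>A (d i) \<noteq> 0" "\<exists>b. \<kappa> i b \<noteq> 0" if "i \<in> I" for i
    using assms(5) row[OF \<psi>A that] that unfolding left_complete_def by force+
  show ?thesis
  proof (intro exI[of _ \<mu>] conjI ballI allI impI)
    fix i j assume "i \<in> I" "j \<in> I"
    then show "(corner p \<psi>A i j \<noteq> (\<lambda>_. 0)) = (j = \<mu> i)"
      using nonzero[of i] by (auto simp: corner[OF \<psi>A] fun_eq_iff)
  next
    fix \<psi>' assume "invariant_functional sA sH sAH tAH \<alpha> \<psi>'"
    then have \<psi>': "invariant \<psi>'" by (simp add: invariant_functional_iff)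
    show "\<exists>c. \<forall>i\<in>I. \<forall>j\<in>I. \<forall>a. corner p \<psi>' i j a =
        (if j = \<mu> i then 1 else 0) * c i * corner p \<psi>A i j a"
      using nonzero(1) by (intro exI[of _ "\<lambda>i. \<psi>' (d i) / \<psi>A (d i)"]) (simp add: corner \<psi>A \<psi>')
  qed (fact \<mu>)
qed

end
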